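(* Let $\{(R_n,B_n)\}_{n=1}^\infty$ be a sequence of admissible pairs in $\mathbb{R}^d$. Let $$\mu_n=\delta_{R_1^{-1}B_1}*\delta_{(R_2R_1)^{-1}B_2}*\cdots*\delta_{(R_n\cdots R_2R_1)^{-1}B_n},$$ and suppose that $\mu_n$ converges weakly to a Borel probability measure $\mu$. Suppose moreover that $\lim_{n\to\infty}\|R_1^{-1}R_2^{-1}\cdots R_n^{-1}\|=0$. For $n\ge1$ let $$\nu_{>n}=\delta_{R_{n+1}^{-1}B_{n+1}}*\delta_{(R_{n+2}R_{n+1})^{-1}B_{n+2}}*\cdots .$$ If some subsequence $\{\nu_{>n_j}\}$ converges weakly to a Borel probability measure $\nu$ with $\mathcal{Z}(\nu)=\emptyset$, then $\mu$ is a spectral measure with a spectrum contained in $\mathbb{Z}^d$.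
   Context: A Borel probability measure $\mu$ on $\mathbb{R}^d$ is a spectral measure if there is a countable set $\Lambda\subseteq\mathbb{R}^d$ (a spectrum) such that $\{e^{2\pi i\lambda\cdot x}:\lambda\in\Lambda\}$ is an orthonormal basis of $L^2(\mu)$. For a finite $A\subseteq\mathbb{R}^d$, $\delta_A=\frac{1}{\#A}\sum_{a\in A}\delta_a$. A pair $(R,B)$ with $R$ a $d\times d$ expanding integer matrix and $B\subseteq\mathbb{Z}^d$ finite is an admissible pair if there is a finite $L\subseteq\mathbb{Z}^d$ with $\#L=\#B$ such that $\big[\frac{1}{\sqrt{\#B}}e^{-2\pi i(R^{-1}b)\cdot\ell}\big]_{b\in B,\ell\in L}$ is unitary. The tail $\nu_{>n}$ is the weak limit of the finite convolutions $\delta_{R_{n+1}^{-1}B_{n+1}}*\cdots*\delta_{(R_{n+k}\cdots R_{n+1})^{-1}B_{n+k}}$ as $k\to\infty$. With $\widehat{\nu}(\xi)=\int e^{-2\pi i\xi\cdot x}d\nu(x)$, the integral periodic zero set is $\mathcal{Z}(\nu)=\{\xi\in\mathbb{R}^d:\widehat{\nu}(\xi+k)=0\text{ for all }k\in\mathbb{Z}^d\}$. *)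

theory Defs
  imports "HOL-Probability.Probability"
begin

definition int_lattice :: "(real ^ 'n) set" where
  "int_lattice = {k. \<forall>i. k $ i \<in> \<int>}"

definition integer_matrix :: "real ^ 'n ^ 'n \<Rightarrow> bool" where
  "integer_matrix R \<longleftrightarrow> (\<forall>i j. R $ i $ j \<in> \<int>)"

definition expanding :: "real ^ 'n ^ 'n \<Rightarrow> bool" where
  "expanding R \<longleftrightarrow>
     (\<forall>(c::complex) (v::complex ^ 'n). v \<noteq> 0 \<and>
        (\<chi> i j. complex_of_real (R $ i $ j)) *v v = c *s v \<longrightarrow> 1 < cmod c)"

definition admissible_pair :: "real ^ 'n ^ 'n \<Rightarrow> (real ^ 'n) set \<Rightarrow> bool" where
  "admissible_pair R B \<longleftrightarrow>
     integer_matrix R \<and> expanding R \<and> finite B \<and> B \<noteq> {} \<and> B \<subseteq> int_lattice \<and>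
     (\<exists>L. finite L \<and> L \<subseteq> int_lattice \<and> card L = card B \<and>
        (let M = (\<lambda>b l. complex_of_real (1 / sqrt (real (card B))) *
                          cis (- 2 * pi * ((matrix_inv R *v b) \<bullet> l)))
         in (\<forall>l\<in>L. \<forall>l'\<in>L. (\<Sum>b\<in>B. cnj (M b l) * M b l') = (if l = l' then 1 else 0)) \<and>
            (\<forall>b\<in>B. \<forall>b'\<in>B. (\<Sum>l\<in>L. M b l * cnj (M b' l)) = (if b = b' then 1 else 0))))"

definition delta_set :: "(real ^ 'n) set \<Rightarrow> (real ^ 'n) measure" where
  "delta_set A = distr (uniform_count_measure A) borel (\<lambda>x. x)"

definition conv :: "(real ^ 'n) measure \<Rightarrow> (real ^ 'n) measure \<Rightarrow> (real ^ 'n) measure" where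
  "conv M N = distr (M \<Otimes>\<^sub>M N) borel (\<lambda>(x, y). x + y)"

fun conv_seq :: "(nat \<Rightarrow> (real ^ 'n) measure) \<Rightarrow> nat \<Rightarrow> (real ^ 'n) measure" where
  "conv_seq F 0 = return borel 0"
| "conv_seq F (Suc n) = conv (conv_seq F n) (F (Suc n))"

fun matprod :: "(nat \<Rightarrow> real ^ 'n ^ 'n) \<Rightarrow> nat \<Rightarrow> nat \<Rightarrow> real ^ 'n ^ 'n" where
  "matprod R m 0 = mat 1"
| "matprod R m (Suc k) = R (m + Suc k) ** matprod R m k"

fun invprod :: "(nat \<Rightarrow> real ^ 'n ^ 'n) \<Rightarrow> nat \<Rightarrow> real ^ 'n ^ 'n" where
  "invprod R 0 = mat 1"
| "invprod R (Suc n) = invprod R n ** matrix_inv (R (Suc n))"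

definition factor :: "(nat \<Rightarrow> real ^ 'n ^ 'n) \<Rightarrow> (nat \<Rightarrow> (real ^ 'n) set) \<Rightarrow> nat \<Rightarrow> nat
    \<Rightarrow> (real ^ 'n) measure" where
  "factor R B m k = delta_set ((\<lambda>b. matrix_inv (matprod R m k) *v b) ` B (m + k))"

definition weak_conv_to :: "(nat \<Rightarrow> (real ^ 'n) measure) \<Rightarrow> (real ^ 'n) measure \<Rightarrow> bool" where
  "weak_conv_to Ms M \<longleftrightarrow>
     (\<forall>f :: real ^ 'n \<Rightarrow> real. continuous_on UNIV f \<and> bounded (range f) \<longrightarrow>
        (\<lambda>k. integral\<^sup>L (Ms k) f) \<longlonglongrightarrow> integral\<^sup>L M f)"

definition borel_prob :: "(real ^ 'n) measure \<Rightarrow> bool" where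
  "borel_prob M \<longleftrightarrow> prob_space M \<and> sets M = sets borel"

definition fourier :: "(real ^ 'n) measure \<Rightarrow> real ^ 'n \<Rightarrow> complex" where
  "fourier M \<xi> = integral\<^sup>L M (\<lambda>x. cis (- 2 * pi * (\<xi> \<bullet> x)))"

definition periodic_zero_set :: "(real ^ 'n) measure \<Rightarrow> (real ^ 'n) set" where
  "periodic_zero_set M = {\<xi>. \<forall>k\<in>int_lattice. fourier M (\<xi> + k) = 0}"

definition expo :: "real ^ 'n \<Rightarrow> real ^ 'n \<Rightarrow> complex" where
  "expo l x = cis (2 * pi * (l \<bullet> x))"

text \<open>Lambda is a spectrum of M: Lambda countable and {e_lambda} is an orthonormal
  basis of L^2(M), i.e. orthonormal and complete (only the zero class is orthogonal to all).\<close>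
definition spectrum_of :: "(real ^ 'n) measure \<Rightarrow> (real ^ 'n) set \<Rightarrow> bool" where
  "spectrum_of M \<Lambda> \<longleftrightarrow> countable \<Lambda> \<and>
     (\<forall>l\<in>\<Lambda>. \<forall>l'\<in>\<Lambda>. integral\<^sup>L M (\<lambda>x. expo l x * cnj (expo l' x)) =
        (if l = l' then 1 else 0)) \<and>
     (\<forall>f :: real ^ 'n \<Rightarrow> complex. f \<in> borel_measurable M \<and> integrable M (\<lambda>x. (cmod (f x))\<^sup>2) \<and>
        (\<forall>l\<in>\<Lambda>. integral\<^sup>L M (\<lambda>x. f x * cnj (expo l x)) = 0) \<longrightarrow> (AE x in M. f x = 0))"

definition spectral_measure :: "(real ^ 'n) measure \<Rightarrow> bool" where
  "spectral_measure M \<longleftrightarrow> (\<exists>\<Lambda>. spectrum_of M \<Lambda>)"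

end

theory Submission
  imports Defs
begin

text \<open>
  Let \<open>\<mu>\<^sub>n\<close> be the \<open>n\<close>-th partial convolution and \<open>P\<^sub>n = R\<^sub>n \<cdots> R\<^sub>1\<close>. Its Fourier transform is
  periodic under \<open>P\<^sub>n\<^sup>T \<int>\<^sup>d\<close>, and the transform of \<open>\<mu>\<close> at \<open>\<xi>\<close> is that of \<open>\<mu>\<^sub>n\<close> at \<open>\<xi>\<close> times that of
  the tail \<open>\<nu>\<^sub>>\<^sub>n\<close> at \<open>P\<^sub>n\<^sup>-\<^sup>T \<xi>\<close>. Admissibility gives finite integral spectra \<open>\<Lambda>\<close> of \<open>\<mu>\<^sub>n\<close>, in the form
  that the squared transform of \<open>\<mu>\<^sub>n\<close> sums to \<open>1\<close> over every translate of \<open>\<Lambda>\<close>; an element of \<open>\<Lambda>\<close>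
  may be moved by a period. Since the periodic zero set of \<open>\<nu>\<close> is empty, compactness
  of the unit cube allows us to choose these moves along the subsequence so that the transform of
  the tail stays away from \<open>0\<close> at all points \<open>P\<^sub>n\<^sup>-\<^sup>T (\<xi> + \<lambda>)\<close>, while keeping the spectra nested.
  A domination argument then shows that the squared transform of \<open>\<mu>\<close> sums to \<open>1\<close> over every translate
  of the union, so all exponentials lie in the closed span of those with frequency in the union,
  and the uniqueness theorem for Fourier transforms yields completeness.
\<close>

section \<open>Uniqueness of Fourier transforms\<close>

text \<open>This is the vanishing of the Fourier transform of the complex measure with density
  \<open>f\<close> with respect to \<open>M\<close>. The sign in the exponent is immaterial because
  \<open>\<xi>\<close> ranges over all frequencies.\<close>

definition fourier_null :: "(real ^ 'n) measure \<Rightarrow> (real ^ 'n \<Rightarrow> complex) \<Rightarrow> bool" where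
  "fourier_null M f \<longleftrightarrow> integrable M f \<and> (\<forall>\<xi>. (\<integral>x. f x * expo \<xi> x \<partial>M) = 0)"

text \<open>The multipliers form an algebra that contains the trigonometric functions and is closed under
  bounded pointwise limits; hence it contains the indicators of all Borel sets.\<close>
definition null_multiplier :: "(real ^ 'n) measure \<Rightarrow> (real ^ 'n \<Rightarrow> real) \<Rightarrow> bool" where
  "null_multiplier M \<phi> \<longleftrightarrow> \<phi> \<in> borel_measurable borel \<and> (\<exists>C. \<forall>x. \<bar>\<phi> x\<bar> \<le> C) \<and>
     (\<forall>f. fourier_null M f \<longrightarrow> fourier_null M (\<lambda>x. complex_of_real (\<phi> x) * f x))"

lemma expo_add: "expo (\<xi> + \<eta>) x = expo \<xi> x * expo \<eta> x"
  by (simp add: expo_def inner_add_left cis_mult distrib_left)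

lemma norm_expo [simp]: "cmod (expo \<xi> x) = 1"
  by (simp add: expo_def)

lemma expo_measurable [measurable]: "expo \<xi> \<in> borel_measurable borel"
proof -
  have "continuous_on UNIV (expo \<xi>)"
    unfolding expo_def cis_conv_exp by (intro continuous_intros)
  then show ?thesis by (rule borel_measurable_continuous_onI)
qed

lemma integrable_bounded_mult:
  fixes f g :: "real ^ 'n \<Rightarrow> complex"
  assumes sets: "sets M = sets borel" and f: "integrable M f"
    and g: "g \<in> borel_measurable borel" "\<And>x. cmod (g x) \<le> C"
  shows "integrable M (\<lambda>x. g x * f x)" "integrable M (\<lambda>x. f x * g x)"
proof -
  have [measurable]: "f \<in> borel_measurable M" "g \<in> borel_measurable M"
    using borel_measurable_integrable[OF f] g(1) by (simp_all add: measurable_cong_sets[OF sets refl])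
  have C: "0 \<le> C" using order_trans[OF norm_ge_zero g(2)] by blast
  show *: "integrable M (\<lambda>x. g x * f x)"
  proof (rule Bochner_Integration.integrable_bound[OF integrable_mult_right[OF integrable_norm[OF f], of C]])
    show "AE x in M. norm (g x * f x) \<le> norm (C * norm (f x))"
      using C g(2) by (auto simp: norm_mult mult_right_mono)
  qed simp
  show "integrable M (\<lambda>x. f x * g x)" using * by (simp add: mult.commute)
qed

lemma fourier_null_integrable:
  assumes "sets M = sets borel" "fourier_null M f"
  shows "integrable M (\<lambda>x. f x * expo \<xi> x)"
  using integrable_bounded_mult(2)[of M f "expo \<xi>" 1] assms
  by (auto simp: fourier_null_def)

lemma fourier_null_expo:
  assumes s: "sets M = sets borel" and f: "fourier_null M f"
  shows "fourier_null M (\<lambda>x. expo \<eta> x * f x)"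
  unfolding fourier_null_def
proof (intro conjI allI)
  show "integrable M (\<lambda>x. expo \<eta> x * f x)"
    using fourier_null_integrable[OF assms] by (simp add: mult.commute)
  have "(\<lambda>x. expo \<eta> x * f x * expo \<xi> x) = (\<lambda>x. f x * expo (\<eta> + \<xi>) x)" for \<xi>
    by (simp add: expo_add fun_eq_iff)
  then show "(\<integral>x. expo \<eta> x * f x * expo \<xi> x \<partial>M) = 0" for \<xi>
    using f by (simp only: fourier_null_def)
qed

lemma fourier_null_cmult:
  "fourier_null M f \<Longrightarrow> fourier_null M (\<lambda>x. c * f x)"
  by (auto simp: fourier_null_def mult.assoc)

lemma fourier_null_add:
  assumes "sets M = sets borel" "fourier_null M f" "fourier_null M g"
  shows "fourier_null M (\<lambda>x. f x + g x)"
  using assms fourier_null_integrable[OF assms(1)]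
  by (auto simp: fourier_null_def distrib_right Bochner_Integration.integral_add)

lemma null_multiplier_const: "null_multiplier M (\<lambda>x. c)"
  unfolding null_multiplier_def by (auto intro: fourier_null_cmult)

lemma null_multiplier_mult:
  assumes "null_multiplier M \<phi>" "null_multiplier M \<psi>"
  shows "null_multiplier M (\<lambda>x. \<phi> x * \<psi> x)"
proof -
  from assms obtain C D where C: "\<And>x. \<bar>\<phi> x\<bar> \<le> C" and D: "\<And>x. \<bar>\<psi> x\<bar> \<le> D"
    unfolding null_multiplier_def by blast
  have "\<bar>\<phi> x * \<psi> x\<bar> \<le> C * D" for x
    unfolding abs_mult by (rule mult_mono) (use C D order_trans[OF abs_ge_zero C] in auto)
  then show ?thesis
    using assms unfolding null_multiplier_def by (auto simp: mult.assoc)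
qed

lemma null_multiplier_add:
  assumes s: "sets M = sets borel" and "null_multiplier M \<phi>" "null_multiplier M \<psi>"
  shows "null_multiplier M (\<lambda>x. \<phi> x + \<psi> x)"
proof -
  from assms obtain C D where C: "\<And>x. \<bar>\<phi> x\<bar> \<le> C" and D: "\<And>x. \<bar>\<psi> x\<bar> \<le> D"
    unfolding null_multiplier_def by blast
  have "\<bar>\<phi> x + \<psi> x\<bar> \<le> C + D" for x
    using C[of x] D[of x] by linarith
  then show ?thesis
    using assms unfolding null_multiplier_def
    by (auto simp: distrib_right intro!: fourier_null_add)
qed

text \<open>Dominated convergence with majorant \<open>C * norm (f x)\<close>. This is the closure
  property that leads from trigonometric polynomials to indicator functions.\<close>

lemma null_multiplier_limit:
  assumes s: "sets M = sets borel" and \<phi>: "\<And>n. null_multiplier M (\<phi> n)"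
    and C: "\<And>n x. \<bar>\<phi> n x\<bar> \<le> C" and lim: "\<And>x. (\<lambda>n. \<phi> n x) \<longlonglongrightarrow> \<psi> x"
  shows "null_multiplier M \<psi>"
proof -
  have m [measurable]: "\<phi> n \<in> borel_measurable borel" for n
    using \<phi> by (simp add: null_multiplier_def)
  have \<psi>m [measurable]: "\<psi> \<in> borel_measurable borel"
    by (rule borel_measurable_LIMSEQ_metric[OF m lim])
  have \<psi>C: "\<bar>\<psi> x\<bar> \<le> C" for x
    by (rule LIMSEQ_le_const2[OF tendsto_rabs[OF lim]]) (use C in auto)
  have "fourier_null M (\<lambda>x. complex_of_real (\<psi> x) * f x)" if f: "fourier_null M f" for f
    unfolding fourier_null_def
  proof (intro conjI allI)
    have fi: "integrable M f" using f by (simp add: fourier_null_def)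
    then have [measurable]: "f \<in> borel_measurable M" by simp
    have mM [measurable]: "\<phi> n \<in> borel_measurable M" "\<psi> \<in> borel_measurable M" "expo \<xi> \<in> borel_measurable M" for n \<xi>
      by (simp_all add: measurable_cong_sets[OF s refl])
    show "integrable M (\<lambda>x. complex_of_real (\<psi> x) * f x)"
      by (rule integrable_bounded_mult(1)[OF s fi, where C = C]) (use \<psi>C in auto)
    fix \<xi>
    have "(\<lambda>n. \<integral>x. complex_of_real (\<phi> n x) * f x * expo \<xi> x \<partial>M)
      \<longlonglongrightarrow> (\<integral>x. complex_of_real (\<psi> x) * f x * expo \<xi> x \<partial>M)"
    proof (rule integral_dominated_convergence[where w = "\<lambda>x. C * norm (f x)"])
      show "AE x in M. (\<lambda>n. complex_of_real (\<phi> n x) * f x * expo \<xi> x)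
        \<longlonglongrightarrow> complex_of_real (\<psi> x) * f x * expo \<xi> x"
        by (intro AE_I2 tendsto_mult tendsto_of_real lim tendsto_const)
      show "AE x in M. norm (complex_of_real (\<phi> n x) * f x * expo \<xi> x) \<le> C * norm (f x)" for n
        using C by (auto simp: norm_mult mult_right_mono)
    qed (use fi in auto)
    moreover have "(\<integral>x. complex_of_real (\<phi> n x) * f x * expo \<xi> x \<partial>M) = 0" for n
      using \<phi>[of n] f by (auto simp: null_multiplier_def fourier_null_def)
    ultimately show "(\<integral>x. complex_of_real (\<psi> x) * f x * expo \<xi> x \<partial>M) = 0"
      by (simp add: LIMSEQ_const_iff)
  qed
  then show ?thesis
    using \<psi>m \<psi>C by (auto simp: null_multiplier_def)
qed

text \<open>Sine is a combination of two exponentials, and multiplying \<open>f\<close> by an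
  exponential only translates its transform. The rescaling of \<open>\<eta>\<close> undoes the
  factor 2 pi in \<open>expo\<close>.\<close>

lemma null_multiplier_sin:
  assumes s: "sets M = sets borel"
  shows "null_multiplier M (\<lambda>x. sin (\<eta> \<bullet> x))"
proof -
  let ?\<zeta> = "\<eta> /\<^sub>R (2 * pi)"
  have e: "complex_of_real (sin (\<eta> \<bullet> x)) = expo ?\<zeta> x * (- \<i> / 2) + expo (- ?\<zeta>) x * (\<i> / 2)" for x
    by (simp add: complex_eq_iff expo_def cis.ctr field_simps)
  have "fourier_null M (\<lambda>x. complex_of_real (sin (\<eta> \<bullet> x)) * f x)" if f: "fourier_null M f" for f
  proof -
    have "fourier_null M (\<lambda>x. (- \<i> / 2) * (expo ?\<zeta> x * f x) + (\<i> / 2) * (expo (- ?\<zeta>) x * f x))"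
      by (intro fourier_null_add fourier_null_cmult fourier_null_expo f s)
    then show ?thesis
      by (simp add: e algebra_simps)
  qed
  then show ?thesis
    by (auto simp: null_multiplier_def intro!: exI[of _ 1])
qed

lemma null_multiplier_poly:
  assumes s: "sets M = sets borel" and "null_multiplier M \<phi>" and "real_polynomial_function p"
  shows "null_multiplier M (\<lambda>x. p (\<phi> x))"
  using assms(3)
proof induction
  case (linear h)
  then obtain c where "h = (\<lambda>x. x * c)"
    using real_bounded_linear by blast
  then show ?case
    using null_multiplier_mult[OF assms(2) null_multiplier_const[of M c]] by simp
qed (auto intro: null_multiplier_const null_multiplier_add[OF s] null_multiplier_mult)

text \<open>The multiplier takes values in a compact interval, where Weierstrass gives polynomials
  tending uniformly to \<open>G\<close>. Errors of at most 1 keep the approximants bounded by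
  \<open>D + 1\<close>.\<close>

lemma null_multiplier_continuous:
  fixes G :: "real \<Rightarrow> real"
  assumes s: "sets M = sets borel" and \<phi>: "null_multiplier M \<phi>" and G: "continuous_on UNIV G"
  shows "null_multiplier M (\<lambda>x. G (\<phi> x))"
proof -
  obtain C where C: "\<And>x. \<bar>\<phi> x\<bar> \<le> C" using \<phi> unfolding null_multiplier_def by blast
  then have mem: "\<phi> x \<in> {-C..C}" for x by (auto simp: abs_le_iff minus_le_iff)
  have Gc: "continuous_on {-C..C} G" using G continuous_on_subset by blast
  have "\<exists>p. real_polynomial_function p \<and> (\<forall>x\<in>{-C..C}. \<bar>G x - p x\<bar> < inverse (real (Suc n)))" for n
    using Stone_Weierstrass_real_polynomial_function[OF compact_Icc Gc, of "inverse (real (Suc n))"]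
    by (metis inverse_positive_iff_positive of_nat_0_less_iff zero_less_Suc)
  then obtain p where p: "\<And>n. real_polynomial_function (p n)"
    "\<And>n x. x \<in> {-C..C} \<Longrightarrow> \<bar>G x - p n x\<bar> < inverse (real (Suc n))" by metis
  obtain D where D: "\<And>x. x \<in> {-C..C} \<Longrightarrow> \<bar>G x\<bar> \<le> D"
    using compact_imp_bounded[OF compact_continuous_image[OF Gc compact_Icc]]
    unfolding bounded_iff by (metis imageI real_norm_def)
  show ?thesis
  proof (rule null_multiplier_limit[OF s, where \<phi> = "\<lambda>n x. p n (\<phi> x)" and C = "D + 1"])
    show "\<bar>p n (\<phi> x)\<bar> \<le> D + 1" for n x
    proof -
      have "inverse (real (Suc n)) \<le> 1" by (simp add: field_simps)
      then show ?thesis using p(2)[OF mem[of x], of n] D[OF mem[of x]] by linarith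
    qed
    show "(\<lambda>n. p n (\<phi> x)) \<longlonglongrightarrow> G (\<phi> x)" for x
    proof (rule LIM_zero_cancel, rule Lim_null_comparison)
      show "\<forall>\<^sub>F n in sequentially. norm (p n (\<phi> x) - G (\<phi> x)) \<le> inverse (real (Suc n))"
        using p(2)[OF mem[of x]] by (auto intro!: always_eventually less_imp_le simp: abs_minus_commute)
    qed (rule LIMSEQ_inverse_real_of_nat)
  qed (rule null_multiplier_poly[OF s \<phi> p(1)])
qed

text \<open>\<open>n sin (t / n)\<close> tends to \<open>t\<close>, so bounded continuous functions of a linear form are limits of
  continuous functions of a bounded trigonometric one.\<close>
lemma null_multiplier_inner:
  fixes G :: "real \<Rightarrow> real"
  assumes s: "sets M = sets borel" and G: "continuous_on UNIV G" and D: "\<And>u. \<bar>G u\<bar> \<le> D"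
  shows "null_multiplier M (\<lambda>x. G (\<eta> \<bullet> x))"
proof (rule null_multiplier_limit[OF s,
      where \<phi> = "\<lambda>n x. G (real (Suc n) * sin ((\<eta> /\<^sub>R real (Suc n)) \<bullet> x))"])
  show "null_multiplier M (\<lambda>x. G (real (Suc n) * sin ((\<eta> /\<^sub>R real (Suc n)) \<bullet> x)))" for n
    by (rule null_multiplier_continuous[OF s
          null_multiplier_mult[OF null_multiplier_const null_multiplier_sin[OF s]] G])
  show "(\<lambda>n. G (real (Suc n) * sin ((\<eta> /\<^sub>R real (Suc n)) \<bullet> x))) \<longlonglongrightarrow> G (\<eta> \<bullet> x)" for x
  proof (rule continuous_on_tendsto_compose[OF G])
    define t where "t = \<eta> \<bullet> x"
    have "((\<lambda>u. sin (t * u) / u) \<longlongrightarrow> t) (at 0)"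
    proof -
      have "((\<lambda>u. sin (t * u)) has_field_derivative t) (at 0)"
        by (auto intro!: derivative_eq_intros)
      then show ?thesis by (simp add: has_field_derivative_iff)
    qed
    moreover have "filterlim (\<lambda>n. inverse (real (Suc n))) (at 0) sequentially"
      unfolding filterlim_at using LIMSEQ_inverse_real_of_nat by auto
    ultimately have "(\<lambda>n. sin (t * inverse (real (Suc n))) / inverse (real (Suc n))) \<longlonglongrightarrow> t"
      by (rule filterlim_compose)
    then show "(\<lambda>n. real (Suc n) * sin ((\<eta> /\<^sub>R real (Suc n)) \<bullet> x)) \<longlonglongrightarrow> \<eta> \<bullet> x"
      by (simp add: t_def field_simps)
  qed auto
qed (rule D)

text \<open>The indicator is the pointwise limit of ramps in the linear form that equal 1 up to
  \<open>a\<close> and fall to 0 with slope \<open>-n\<close>.\<close>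

lemma null_multiplier_halfspace:
  assumes s: "sets M = sets borel"
  shows "null_multiplier M (indicat_real {x. x \<bullet> \<eta> \<le> a})"
proof (rule null_multiplier_limit[OF s, where C = 1
      and \<phi> = "\<lambda>n x. max 0 (1 - real n * max 0 (\<eta> \<bullet> x - a))"])
  let ?g = "\<lambda>n u. max 0 (1 - real n * max 0 (u - a))"
  have b: "\<bar>?g n u\<bar> \<le> 1" for n u by auto
  show "null_multiplier M (\<lambda>x. ?g n (\<eta> \<bullet> x))" for n
    by (rule null_multiplier_inner[OF s _ b]) (intro continuous_intros)
  show "\<bar>?g n (\<eta> \<bullet> x)\<bar> \<le> 1" for n x by (rule b)
  show "(\<lambda>n. ?g n (\<eta> \<bullet> x)) \<longlonglongrightarrow> indicat_real {x. x \<bullet> \<eta> \<le> a} x" for x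
  proof (cases "\<eta> \<bullet> x \<le> a")
    case True
    then show ?thesis by (simp add: inner_commute)
  next
    case False
    then obtain N where N: "1 < real N * (\<eta> \<bullet> x - a)"
      using reals_Archimedean3[of "\<eta> \<bullet> x - a"] by auto
    have "?g n (\<eta> \<bullet> x) = 0" if "n \<ge> N" for n
    proof -
      have "real N * (\<eta> \<bullet> x - a) \<le> real n * (\<eta> \<bullet> x - a)"
        using that False by (intro mult_right_mono) auto
      then have "1 < real n * (\<eta> \<bullet> x - a)" using N by linarith
      then show ?thesis using False by (simp add: max_absorb1 max_absorb2)
    qed
    then have "\<forall>\<^sub>F n in sequentially. ?g n (\<eta> \<bullet> x) = 0"
      by (auto simp: eventually_sequentially)
    then show ?thesis using False
      by (simp add: inner_commute tendsto_eventually)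
  qed
qed

lemma null_multiplier_indicator_Un:
  assumes s: "sets M = sets borel" and "null_multiplier M (indicat_real A)" "null_multiplier M (indicat_real C)"
  shows "null_multiplier M (indicat_real (A \<union> C))"
proof -
  have "indicat_real (A \<union> C) = (\<lambda>x. indicat_real A x + (indicat_real C x + (-1) * (indicat_real A x * indicat_real C x)))"
    by (auto simp: indicator_def fun_eq_iff)
  then show ?thesis
    by (simp only:) (intro null_multiplier_add null_multiplier_mult null_multiplier_const assms)
qed

text \<open>Half-spaces generate the Borel sets. Since multipliers are also closed under products, a
  direct induction over the generated sigma-algebra works, with no need for disjoint unions.\<close>

lemma null_multiplier_borel:
  fixes A :: "(real ^ 'n) set"
  assumes s: "sets M = sets borel" and A: "A \<in> sets borel"
  shows "null_multiplier M (indicat_real A)"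
proof -
  let ?E = "(\<lambda>(a, i). {x :: real ^ 'n. x \<bullet> i \<le> a}) ` (UNIV \<times> Basis)"
  have "A \<in> sigma_sets UNIV ?E"
    using A unfolding borel_eq_halfspace_le by (subst (asm) sets_measure_of) auto
  then show ?thesis
  proof induction
    case (Basic a)
    then show ?case by (auto intro: null_multiplier_halfspace[OF s])
  next
    case Empty
    then show ?case using null_multiplier_const[of M 0] by (simp add: indicator_def[abs_def])
  next
    case (Compl a)
    have "indicat_real (UNIV - a) = (\<lambda>x. 1 + (-1) * indicat_real a x)"
      by (auto simp: indicator_def fun_eq_iff)
    then show ?case
      by (simp only:) (intro null_multiplier_add null_multiplier_mult null_multiplier_const Compl s)
  next
    case (Union a)
    \<comment> \<open>Finite unions come first: their indicators are bounded by 1 and converge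
      pointwise to that of the countable union.\<close>
    have "null_multiplier M (indicat_real (\<Union>i<n. a i))" for n
    proof (induction n)
      case 0
      then show ?case using null_multiplier_const[of M 0] by (simp add: indicator_def[abs_def])
    next
      case (Suc n)
      then show ?case using null_multiplier_indicator_Un[OF s Union.IH[of n] Suc]
        by (simp add: lessThan_Suc)
    qed
    then show ?case
      by (rule null_multiplier_limit[OF s _ _ LIMSEQ_indicator_UN, where C = 1]) (auto simp: indicator_def)
  qed
qed

lemma fourier_null_AE_zero:
  assumes "finite_measure M" and s: "sets M = sets borel" and f: "fourier_null M f"
  shows "AE x in M. f x = 0"
proof -
  interpret finite_measure M by fact
  show ?thesis
  proof (rule density_zero)
    show "integrable M f" using f by (simp add: fourier_null_def)
    fix A assume "A \<in> sets M"
    then have "fourier_null M (\<lambda>x. complex_of_real (indicator A x) * f x)"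
      using null_multiplier_borel[OF s, of A] f s unfolding null_multiplier_def by auto
    \<comment> \<open>Frequency 0 turns the vanishing transform into a vanishing integral of
      \<open>f\<close> over \<open>A\<close>.\<close>
    then have "(\<integral>x. complex_of_real (indicator A x) * f x * expo 0 x \<partial>M) = 0"
      unfolding fourier_null_def by blast
    then show "set_lebesgue_integral M A f = 0"
      by (simp add: set_lebesgue_integral_def expo_def scaleR_conv_of_real)
  qed
qed

section \<open>Bessel's inequality and completeness\<close>

lemma expo_0 [simp]: "expo 0 x = 1"
  by (simp add: expo_def)

lemma cnj_expo: "cnj (expo \<xi> x) = expo (- \<xi>) x"
  by (simp add: expo_def cis_cnj)

lemma fourier_eq_expo: "fourier M \<xi> = (\<integral>x. expo (- \<xi>) x \<partial>M)"
  by (simp add: fourier_def expo_def)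

lemma integral_expo_mult_cnj:
  "(\<integral>x. expo l x * cnj (expo l' x) \<partial>M) = fourier M (l' - l)"
  by (simp add: fourier_eq_expo cnj_expo expo_add[symmetric])

lemma borel_measurable_cnj [measurable (raw)]:
  assumes "f \<in> borel_measurable M"
  shows "(\<lambda>x. cnj (f x)) \<in> borel_measurable M"
  using assms by (rule borel_measurable_continuous_on[rotated]) (intro continuous_intros)

lemma borel_prob_prob_space: "borel_prob M \<Longrightarrow> prob_space M"
  and borel_prob_sets: "borel_prob M \<Longrightarrow> sets M = sets borel"
  by (simp_all add: borel_prob_def)

lemma borel_prob_measurable: "borel_prob M \<Longrightarrow> borel_measurable M = borel_measurable borel"
  by (rule measurable_cong_sets) (simp_all add: borel_prob_def)

lemma borel_prob_integrable_bounded: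
  fixes g :: "real ^ 'n \<Rightarrow> 'b::{banach, second_countable_topology}"
  assumes M: "borel_prob M" and "g \<in> borel_measurable borel" "\<And>x. norm (g x) \<le> C"
  shows "integrable M g"
proof -
  interpret prob_space M using M by (rule borel_prob_prob_space)
  show ?thesis
    by (rule integrable_const_bound[where B = C])
      (use assms in \<open>auto simp: borel_prob_measurable[OF M]\<close>)
qed

lemma integrable_expo: "borel_prob M \<Longrightarrow> integrable M (expo \<xi>)"
  by (rule borel_prob_integrable_bounded[where C = 1]) auto

lemma fourier_0: "borel_prob M \<Longrightarrow> fourier M 0 = 1"
  by (simp add: fourier_eq_expo borel_prob_def prob_space.prob_space)

lemma cnj_fourier: "cnj (fourier M \<xi>) = fourier M (- \<xi>)"
proof -
  have "cnj (fourier M \<xi>) = (\<integral>x. cnj (expo (- \<xi>) x) \<partial>M)"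
    by (simp add: fourier_eq_expo)
  then show ?thesis by (simp add: fourier_eq_expo cnj_expo)
qed

section \<open>Projection of an exponential onto a finite orthonormal family\<close>

context
  fixes M :: "(real ^ 'n) measure" and F :: "(real ^ 'n) set" and \<xi> :: "real ^ 'n"
  assumes M: "borel_prob M" and F: "finite F"
    and orth: "\<And>l l'. l \<in> F \<Longrightarrow> l' \<in> F \<Longrightarrow> l \<noteq> l' \<Longrightarrow> fourier M (l - l') = 0"
begin

text \<open>The part of \<open>expo (- \<xi>)\<close> orthogonal to the span of the exponentials in
  \<open>F\<close>: \<open>fourier M (\<xi> + l)\<close> is the inner product of
  \<open>expo (- \<xi>)\<close> with \<open>expo l\<close>.\<close>

definition residual :: "real ^ 'n \<Rightarrow> complex" where
  "residual x = expo (- \<xi>) x - (\<Sum>l\<in>F. fourier M (\<xi> + l) * expo l x)"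

lemma residual_measurable [measurable]: "residual \<in> borel_measurable borel"
  unfolding residual_def[abs_def] by measurable

lemma residual_bound: "cmod (residual x) \<le> 1 + (\<Sum>l\<in>F. cmod (fourier M (\<xi> + l)))"
proof -
  have "cmod (residual x) \<le> cmod (expo (- \<xi>) x) + cmod (\<Sum>l\<in>F. fourier M (\<xi> + l) * expo l x)"
    unfolding residual_def by (rule norm_triangle_ineq4)
  also have "cmod (\<Sum>l\<in>F. fourier M (\<xi> + l) * expo l x) \<le> (\<Sum>l\<in>F. cmod (fourier M (\<xi> + l)))"
    by (rule sum_norm_le) (simp add: norm_mult)
  finally show ?thesis by simp
qed

lemma integrable_expo_mult: "integrable M (\<lambda>x. expo l x * expo l' x)"
  using integrable_expo[OF M, of "l + l'"] by (simp add: expo_add[abs_def])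

lemma integral_residual_expo:
  "(\<integral>x. residual x * cnj (expo \<eta> x) \<partial>M) =
     fourier M (\<eta> + \<xi>) - (\<Sum>l\<in>F. fourier M (\<xi> + l) * fourier M (\<eta> - l))"
proof -
  have "(\<integral>x. residual x * cnj (expo \<eta> x) \<partial>M) =
      (\<integral>x. expo (- \<xi>) x * cnj (expo \<eta> x) -
        (\<Sum>l\<in>F. fourier M (\<xi> + l) * (expo l x * cnj (expo \<eta> x))) \<partial>M)"
    by (simp add: residual_def left_diff_distrib sum_distrib_right mult.assoc)
  also have "\<dots> = fourier M (\<eta> + \<xi>) - (\<Sum>l\<in>F. fourier M (\<xi> + l) * fourier M (\<eta> - l))"
    using integrable_expo_mult
    by (subst Bochner_Integration.integral_diff)
      (auto simp: cnj_expo[of \<eta>] integral_expo_mult_cnj[of M _ \<eta>, unfolded cnj_expo[of \<eta>]]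
        intro!: Bochner_Integration.integrable_sum integrable_mult_right)
  finally show ?thesis .
qed

lemma integral_residual_expo_zero:
  assumes "\<eta> \<in> F"
  shows "(\<integral>x. residual x * cnj (expo \<eta> x) \<partial>M) = 0"
proof -
  have "(\<Sum>l\<in>F. fourier M (\<xi> + l) * fourier M (\<eta> - l)) =
      (\<Sum>l\<in>F. if l = \<eta> then fourier M (\<xi> + \<eta>) else 0)"
    using orth assms by (intro sum.cong) (auto simp: fourier_0[OF M])
  then show ?thesis
    using F assms by (simp add: integral_residual_expo add.commute)
qed

text \<open>Pythagoras: the residual is orthogonal to each \<open>expo l\<close> with
  \<open>l\<close> in \<open>F\<close>, so in its inner product with itself only the pairing with
  \<open>expo (- \<xi>)\<close> survives.\<close>

lemma integral_residual_sq:
  "(\<integral>x. (cmod (residual x))\<^sup>2 \<partial>M) = 1 - (\<Sum>l\<in>F. (cmod (fourier M (\<xi> + l)))\<^sup>2)"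
proof -
  have i: "integrable M (\<lambda>x. residual x * cnj (expo \<eta> x))" for \<eta>
    using residual_bound
    by (intro borel_prob_integrable_bounded[OF M]) (auto simp: norm_mult)
  have "complex_of_real (\<integral>x. (cmod (residual x))\<^sup>2 \<partial>M) = (\<integral>x. residual x * cnj (residual x) \<partial>M)"
    by (subst integral_complex_of_real[symmetric]) (simp add: complex_norm_square del: of_real_power)
  also have "\<dots> = (\<integral>x. residual x * cnj (expo (- \<xi>) x) -
      (\<Sum>l\<in>F. cnj (fourier M (\<xi> + l)) * (residual x * cnj (expo l x))) \<partial>M)"
  proof -
    have "residual x * cnj (residual x) = residual x * cnj (expo (- \<xi>) x) -
        (\<Sum>l\<in>F. cnj (fourier M (\<xi> + l)) * (residual x * cnj (expo l x)))" for x
      using arg_cong[OF residual_def[of x], of "\<lambda>z. residual x * cnj z"]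
      by (simp add: right_diff_distrib sum_distrib_left mult.left_commute)
    then show ?thesis by simp
  qed
  also have "\<dots> = (\<integral>x. residual x * cnj (expo (- \<xi>) x) \<partial>M)"
    using i by (subst Bochner_Integration.integral_diff)
      (auto simp: integral_residual_expo_zero intro!: Bochner_Integration.integrable_sum integrable_mult_right)
  also have "\<dots> = 1 - (\<Sum>l\<in>F. fourier M (\<xi> + l) * cnj (fourier M (\<xi> + l)))"
    by (simp add: integral_residual_expo fourier_0[OF M] cnj_fourier)
  also have "\<dots> = complex_of_real (1 - (\<Sum>l\<in>F. (cmod (fourier M (\<xi> + l)))\<^sup>2))"
    by (simp add: complex_norm_square del: of_real_power)
  finally show ?thesis by (simp only: of_real_eq_iff)
qed

lemma bessel_fourier: "(\<Sum>l\<in>F. (cmod (fourier M (\<xi> + l)))\<^sup>2) \<le> 1"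
proof -
  have "0 \<le> (\<integral>x. (cmod (residual x))\<^sup>2 \<partial>M)" by simp
  then show ?thesis by (simp add: integral_residual_sq)
qed

text \<open>As \<open>f\<close> is orthogonal to the family, pairing it with
  \<open>expo (- \<xi>)\<close> is the same as pairing it with the residual. The weighted inequality
  between products and squares, with free weight \<open>t\<close>, then takes the place of
  Cauchy-Schwarz.\<close>

lemma cmod_integral_expo_le:
  assumes f: "integrable M f" and f2: "integrable M (\<lambda>x. (cmod (f x))\<^sup>2)"
    and perp: "\<And>l. l \<in> F \<Longrightarrow> (\<integral>x. f x * cnj (expo l x) \<partial>M) = 0" and t: "t > 0"
  shows "cmod (\<integral>x. f x * expo \<xi> x \<partial>M) \<le>
    t / 2 * (\<integral>x. (cmod (f x))\<^sup>2 \<partial>M) + (1 - (\<Sum>l\<in>F. (cmod (fourier M (\<xi> + l)))\<^sup>2)) / (2 * t)"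
proof -
  have i: "integrable M (\<lambda>x. f x * cnj (expo \<eta> x))" for \<eta>
    by (rule integrable_bounded_mult(2)[OF borel_prob_sets[OF M] f, where C = 1]) auto
  have ir: "integrable M (\<lambda>x. f x * cnj (residual x))"
    by (rule integrable_bounded_mult(2)[OF borel_prob_sets[OF M] f,
          where C = "1 + (\<Sum>l\<in>F. cmod (fourier M (\<xi> + l)))"]) (use residual_bound in auto)
  have i2: "integrable M (\<lambda>x. (cmod (residual x))\<^sup>2)"
    by (rule borel_prob_integrable_bounded[OF M, where C = "(1 + (\<Sum>l\<in>F. cmod (fourier M (\<xi> + l))))\<^sup>2"])
      (use power_mono[OF residual_bound norm_ge_zero] in auto)
  have "(\<integral>x. f x * cnj (residual x) \<partial>M) = (\<integral>x. f x * cnj (expo (- \<xi>) x) -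
      (\<Sum>l\<in>F. cnj (fourier M (\<xi> + l)) * (f x * cnj (expo l x))) \<partial>M)"
    by (simp add: residual_def right_diff_distrib sum_distrib_left mult.left_commute)
  also have "\<dots> = (\<integral>x. f x * expo \<xi> x \<partial>M)"
    using i i[of "- \<xi>"] by (subst Bochner_Integration.integral_diff)
      (auto simp: perp cnj_expo[of "- \<xi>"] intro!: Bochner_Integration.integrable_sum integrable_mult_right)
  finally have "cmod (\<integral>x. f x * expo \<xi> x \<partial>M) = cmod (\<integral>x. f x * cnj (residual x) \<partial>M)" by simp
  also have "\<dots> \<le> (\<integral>x. cmod (f x * cnj (residual x)) \<partial>M)"
    by (rule integral_norm_bound)
  also have "\<dots> \<le> (\<integral>x. t / 2 * (cmod (f x))\<^sup>2 + (cmod (residual x))\<^sup>2 / (2 * t) \<partial>M)"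
  proof (rule integral_mono)
    show "cmod (f x * cnj (residual x)) \<le> t / 2 * (cmod (f x))\<^sup>2 + (cmod (residual x))\<^sup>2 / (2 * t)" for x
    proof -
      have "0 \<le> (t * cmod (f x) - cmod (residual x))\<^sup>2" by simp
      then have "2 * t * (cmod (f x) * cmod (residual x)) \<le> t\<^sup>2 * (cmod (f x))\<^sup>2 + (cmod (residual x))\<^sup>2"
        by (simp add: power2_diff power_mult_distrib algebra_simps)
      then show ?thesis using t
        by (simp add: norm_mult field_simps power2_eq_square)
    qed
  qed (use ir f2 i2 in auto)
  also have "\<dots> = t / 2 * (\<integral>x. (cmod (f x))\<^sup>2 \<partial>M) + (\<integral>x. (cmod (residual x))\<^sup>2 \<partial>M) / (2 * t)"
    using f2 i2 by (subst Bochner_Integration.integral_add) auto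
  finally show ?thesis by (simp only: integral_residual_sq)
qed

end

text \<open>Near equality in Bessel's inequality puts every exponential in the closed span of the
  family. A function orthogonal to the family is therefore orthogonal to all exponentials, and
  uniqueness of Fourier transforms makes it zero.\<close>

lemma spectrum_ofI:
  assumes M: "borel_prob M" and \<Lambda>: "countable \<Lambda>"
    and orth: "\<And>l l'. l \<in> \<Lambda> \<Longrightarrow> l' \<in> \<Lambda> \<Longrightarrow> l \<noteq> l' \<Longrightarrow> fourier M (l - l') = 0"
    and dense: "\<And>\<xi> e. e > 0 \<Longrightarrow>
      \<exists>F. finite F \<and> F \<subseteq> \<Lambda> \<and> 1 - e \<le> (\<Sum>l\<in>F. (cmod (fourier M (\<xi> + l)))\<^sup>2)"
  shows "spectrum_of M \<Lambda>"
  unfolding spectrum_of_def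
proof (intro conjI ballI allI impI)
  show "countable \<Lambda>" by fact
  show "(\<integral>x. expo l x * cnj (expo l' x) \<partial>M) = (if l = l' then 1 else 0)"
    if "l \<in> \<Lambda>" "l' \<in> \<Lambda>" for l l'
    using that orth by (auto simp: integral_expo_mult_cnj fourier_0[OF M])
  fix f assume H: "f \<in> borel_measurable M \<and> integrable M (\<lambda>x. (cmod (f x))\<^sup>2) \<and>
    (\<forall>l\<in>\<Lambda>. (\<integral>x. f x * cnj (expo l x) \<partial>M) = 0)"
  then have [measurable]: "f \<in> borel_measurable M" and f2: "integrable M (\<lambda>x. (cmod (f x))\<^sup>2)"
    and perp: "\<And>l. l \<in> \<Lambda> \<Longrightarrow> (\<integral>x. f x * cnj (expo l x) \<partial>M) = 0" by auto
  interpret prob_space M using M by (rule borel_prob_prob_space)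
  have f: "integrable M f"
  proof (rule Bochner_Integration.integrable_bound[where f = "\<lambda>x. 1 + (cmod (f x))\<^sup>2"])
    \<comment> \<open>On a probability space this makes square-integrable functions
      integrable.\<close>
    have "cmod (f x) \<le> 1 + (cmod (f x))\<^sup>2" for x
      using sum_squares_bound[of 1 "cmod (f x)"] norm_ge_zero[of "f x"] by (simp; linarith)
    then show "AE x in M. norm (f x) \<le> norm (1 + (cmod (f x))\<^sup>2)" by auto
  qed (use f2 in auto)
  define A where "A = (\<integral>x. (cmod (f x))\<^sup>2 \<partial>M)"
  have "A \<ge> 0" by (simp add: A_def)
  have bound: "cmod (\<integral>x. f x * expo \<xi> x \<partial>M) \<le> t * (A / 2 + 1 / 2)" if t: "t > 0" for \<xi> t
  proof -
    \<comment> \<open>Tolerance \<open>t\<^sup>2\<close> becomes \<open>t / 2\<close> after division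
      by \<open>2 * t\<close>, so both terms of the bound are of order \<open>t\<close>.\<close>
    obtain F where F: "finite F" "F \<subseteq> \<Lambda>" "1 - t\<^sup>2 \<le> (\<Sum>l\<in>F. (cmod (fourier M (\<xi> + l)))\<^sup>2)"
      using dense[of "t\<^sup>2"] t by auto
    have "cmod (\<integral>x. f x * expo \<xi> x \<partial>M) \<le>
        t / 2 * A + (1 - (\<Sum>l\<in>F. (cmod (fourier M (\<xi> + l)))\<^sup>2)) / (2 * t)"
      unfolding A_def
      by (rule cmod_integral_expo_le[OF M F(1) _ f f2 _ t]) (use orth perp F(2) in auto)
    also have "(1 - (\<Sum>l\<in>F. (cmod (fourier M (\<xi> + l)))\<^sup>2)) / (2 * t) \<le> t\<^sup>2 / (2 * t)"
      using F(3) t by (intro divide_right_mono) auto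
    also have "t / 2 * A + t\<^sup>2 / (2 * t) = t * (A / 2 + 1 / 2)"
      using t by (simp add: field_simps power2_eq_square)
    finally show ?thesis by simp
  qed
  have "(\<integral>x. f x * expo \<xi> x \<partial>M) = 0" for \<xi>
  proof -
    have "cmod (\<integral>x. f x * expo \<xi> x \<partial>M) \<le> 0 + e" if "e > 0" for e
    proof -
      have "A / 2 + 1 / 2 > 0" using \<open>A \<ge> 0\<close> by simp
      then show ?thesis using bound[of "e / (A / 2 + 1 / 2)" \<xi>] that by simp
    qed
    then show ?thesis using field_le_epsilon[of "cmod (\<integral>x. f x * expo \<xi> x \<partial>M)" 0] by simp
  qed
  then have "fourier_null M f" using f by (simp add: fourier_null_def)
  then show "AE x in M. f x = 0"
    using fourier_null_AE_zero[OF finite_measure_axioms borel_prob_sets[OF M]] by blast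
qed

section \<open>Weak convergence and uniform non-vanishing\<close>

lemma weak_conv_to_fourier:
  assumes Ms: "\<And>k. borel_prob (Ms k)" and M: "borel_prob M" and w: "weak_conv_to Ms M"
  shows "(\<lambda>k. fourier (Ms k) \<xi>) \<longlonglongrightarrow> fourier M \<xi>"
proof -
  have b: "bounded (range (\<lambda>x. Re (expo (- \<xi>) x)))" "bounded (range (\<lambda>x. Im (expo (- \<xi>) x)))"
    using abs_Re_le_cmod[of "expo (- \<xi>) _"] abs_Im_le_cmod[of "expo (- \<xi>) _"]
    by (auto simp: bounded_iff intro!: exI[of _ 1])
  have c: "continuous_on UNIV (\<lambda>x. Re (expo (- \<xi>) x))" "continuous_on UNIV (\<lambda>x. Im (expo (- \<xi>) x))"
    by (auto simp: expo_def intro!: continuous_intros)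
  have e: "Re (fourier N \<xi>) = (\<integral>x. Re (expo (- \<xi>) x) \<partial>N)"
    "Im (fourier N \<xi>) = (\<integral>x. Im (expo (- \<xi>) x) \<partial>N)" if "borel_prob N" for N
    using integrable_expo[OF that] by (simp_all add: fourier_eq_expo)
  show ?thesis
    unfolding tendsto_complex_iff e[OF Ms] e[OF M]
    using w b c unfolding weak_conv_to_def by blast
qed

text \<open>The cap at 2 makes the majorant bounded as well as continuous in \<open>x\<close>, so it
  can serve as a test function for weak convergence without any moment condition.\<close>

lemma cmod_expo_diff_le:
  assumes "norm (u - z) \<le> r"
  shows "cmod (expo u x - expo z x) \<le> min 2 (2 * pi * r * norm x)"
proof -
  have "expo u x - expo z x = expo z x * (expo (u - z) x - 1)"
    using expo_add[of "u - z" z x] by (simp add: algebra_simps)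
  then have "cmod (expo u x - expo z x) = cmod (expo (u - z) x - 1)"
    by (simp add: norm_mult)
  also have "\<dots> = cmod (exp (\<i> * complex_of_real (2 * pi * ((u - z) \<bullet> x))) - 1)"
    by (simp only: expo_def cis_conv_exp)
  also have "\<dots> \<le> \<bar>2 * pi * ((u - z) \<bullet> x)\<bar>"
    using iexp_approx1[of "2 * pi * ((u - z) \<bullet> x)" 0] by simp
  also have "\<dots> \<le> 2 * pi * (norm (u - z) * norm x)"
    using Cauchy_Schwarz_ineq2[of "u - z" x] by (simp add: abs_mult)
  also have "\<dots> \<le> 2 * pi * (r * norm x)"
    using assms by (intro mult_left_mono mult_right_mono) auto
  finally have "cmod (expo u x - expo z x) \<le> 2 * pi * r * norm x" by (simp add: mult.assoc)
  moreover have "cmod (expo u x - expo z x) \<le> 2"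
    using norm_triangle_ineq4[of "expo u x" "expo z x"] by simp
  ultimately show ?thesis by simp
qed

lemma fourier_diff_le:
  assumes M: "borel_prob M" and r: "norm (u - z) \<le> r"
  shows "cmod (fourier M u - fourier M z) \<le> (\<integral>x. min 2 (2 * pi * r * norm x) \<partial>M)"
proof -
  have r0: "0 \<le> r" using r norm_ge_zero order_trans by blast
  have "fourier M u - fourier M z = (\<integral>x. expo (- u) x - expo (- z) x \<partial>M)"
    unfolding fourier_eq_expo
    by (rule Bochner_Integration.integral_diff[symmetric]) (intro integrable_expo M)+
  also have "cmod \<dots> \<le> (\<integral>x. cmod (expo (- u) x - expo (- z) x) \<partial>M)"
    by (rule integral_norm_bound)
  also have "\<dots> \<le> (\<integral>x. min 2 (2 * pi * r * norm x) \<partial>M)"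
  proof (rule integral_mono)
    show "integrable M (\<lambda>x. cmod (expo (- u) x - expo (- z) x))"
      by (intro integrable_norm Bochner_Integration.integrable_diff integrable_expo M)
    show "integrable M (\<lambda>x. min 2 (2 * pi * r * norm x))"
      by (rule borel_prob_integrable_bounded[OF M, where C = 2]) (use r0 in auto)
    show "cmod (expo (- u) x - expo (- z) x) \<le> min 2 (2 * pi * r * norm x)" for x
      by (rule cmod_expo_diff_le) (use r in \<open>simp add: norm_minus_commute\<close>)
  qed
  finally show ?thesis .
qed

lemma fourier_modulus_tendsto_0:
  fixes M :: "(real ^ 'n) measure"
  assumes M: "borel_prob M"
  shows "(\<lambda>n. \<integral>x. min 2 (2 * pi * inverse (real (Suc n)) * norm x) \<partial>M) \<longlonglongrightarrow> 0"
proof -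
  interpret prob_space M using M by (rule borel_prob_prob_space)
  have "(\<lambda>n. \<integral>x. min 2 (2 * pi * inverse (real (Suc n)) * norm x) \<partial>M) \<longlonglongrightarrow> (\<integral>x. 0 \<partial>M)"
  proof (rule integral_dominated_convergence[where w = "\<lambda>x. 2"])
    have "(\<lambda>n. min 2 (2 * pi * inverse (real (Suc n)) * norm x)) \<longlonglongrightarrow> min 2 (2 * pi * 0 * norm x)" for x :: "real ^ 'n"
      by (intro tendsto_intros LIMSEQ_inverse_real_of_nat)
    then show "AE x in M. (\<lambda>n. min 2 (2 * pi * inverse (real (Suc n)) * norm x)) \<longlonglongrightarrow> 0" by simp
    show "(\<lambda>x. min 2 (2 * pi * inverse (real (Suc n)) * norm x)) \<in> borel_measurable M" for n
      unfolding borel_prob_measurable[OF M] by measurable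
  qed auto
  then show ?thesis by simp
qed

text \<open>The modulus of continuity is bounded by the integral of a bounded continuous function,
  so weak convergence makes the transforms eventually equicontinuous.\<close>
lemma fourier_nonvanishing_near:
  fixes M :: "(real ^ 'n) measure"
  assumes Ms: "\<And>k. borel_prob (Ms k)" and M: "borel_prob M" and w: "weak_conv_to Ms M"
    and z: "fourier M z \<noteq> 0"
  shows "\<exists>e>0. \<forall>\<^sub>F j in sequentially. \<forall>u. norm (u - z) < e \<longrightarrow> e \<le> cmod (fourier (Ms j) u)"
proof -
  define a where "a = cmod (fourier M z)"
  have a: "a > 0" using z by (simp add: a_def)
  define g :: "real \<Rightarrow> real ^ 'n \<Rightarrow> real" where "g r x = min 2 (2 * pi * r * norm x)" for r x
  have "\<forall>\<^sub>F n in sequentially. (\<integral>x. g (inverse (real (Suc n))) x \<partial>M) < a / 4"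
    using fourier_modulus_tendsto_0[OF M] a unfolding g_def by (intro order_tendstoD(2)) auto
  then obtain n where n: "(\<integral>x. g (inverse (real (Suc n))) x \<partial>M) < a / 4"
    using eventually_happens by fastforce
  define r where "r = inverse (real (Suc n))"
  have r: "r > 0" by (simp add: r_def)
  have "continuous_on UNIV (g r)" unfolding g_def by (intro continuous_intros)
  moreover have "bounded (range (g r))"
    unfolding g_def bounded_iff using r by (intro exI[of _ 2]) auto
  ultimately have "(\<lambda>j. \<integral>x. g r x \<partial>Ms j) \<longlonglongrightarrow> (\<integral>x. g r x \<partial>M)"
    using w by (simp add: weak_conv_to_def)
  then have 1: "\<forall>\<^sub>F j in sequentially. (\<integral>x. g r x \<partial>Ms j) < a / 4"
    using n unfolding r_def by (rule order_tendstoD(2))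
  have 2: "\<forall>\<^sub>F j in sequentially. a / 2 < cmod (fourier (Ms j) z)"
    using tendsto_norm[OF weak_conv_to_fourier[OF Ms M w, of z]] a
    by (intro order_tendstoD(1)) (auto simp: a_def)
  show ?thesis
  proof (intro exI conjI)
    \<comment> \<open>One number serves both as radius and as lower bound: near \<open>z\<close> the
      modulus exceeds \<open>a / 2 - a / 4\<close>.\<close>
    show "min r (a / 4) > 0" using r a by simp
    show "\<forall>\<^sub>F j in sequentially. \<forall>u. norm (u - z) < min r (a / 4) \<longrightarrow> min r (a / 4) \<le> cmod (fourier (Ms j) u)"
      using 1 2
    proof eventually_elim
      case (elim j)
      show ?case
      proof (intro allI impI)
        fix u assume "norm (u - z) < min r (a / 4)"
        then have "cmod (fourier (Ms j) u - fourier (Ms j) z) < a / 4"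
          using fourier_diff_le[OF Ms, of u z r j] elim unfolding g_def by simp
        moreover have "cmod (fourier (Ms j) z) - cmod (fourier (Ms j) u) \<le> cmod (fourier (Ms j) u - fourier (Ms j) z)"
          by (metis norm_minus_commute norm_triangle_ineq2)
        ultimately show "min r (a / 4) \<le> cmod (fourier (Ms j) u)"
          using elim by linarith
      qed
    qed
  qed
qed

lemma int_lattice_0 [simp]: "0 \<in> int_lattice"
  by (simp add: int_lattice_def)

lemma int_lattice_add: "x \<in> int_lattice \<Longrightarrow> y \<in> int_lattice \<Longrightarrow> x + y \<in> int_lattice"
  by (simp add: int_lattice_def)

lemma int_lattice_diff: "x \<in> int_lattice \<Longrightarrow> y \<in> int_lattice \<Longrightarrow> x - y \<in> int_lattice"
  by (simp add: int_lattice_def)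

lemma int_lattice_inner: "x \<in> int_lattice \<Longrightarrow> y \<in> int_lattice \<Longrightarrow> x \<bullet> y \<in> \<int>"
  unfolding int_lattice_def inner_vec_def by (auto intro!: Ints_sum Ints_mult)

lemma int_lattice_vector_matrix:
  "x \<in> int_lattice \<Longrightarrow> integer_matrix A \<Longrightarrow> x v* A \<in> int_lattice"
  by (auto simp: int_lattice_def integer_matrix_def vector_matrix_mult_def intro!: Ints_sum Ints_mult)

text \<open>Each point has an integer translate near which the transforms stay away from 0. Finitely
  many such neighbourhoods cover the unit cube, and integer shifts reduce all other points to the
  cube.\<close>

lemma fourier_uniformly_nonvanishing:
  fixes M :: "(real ^ 'n) measure"
  assumes Ms: "\<And>k. borel_prob (Ms k)" and M: "borel_prob M" and w: "weak_conv_to Ms M"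
    and Z: "periodic_zero_set M = {}"
  shows "\<exists>e>0. \<forall>\<^sub>F j in sequentially.
    (\<forall>x. \<exists>k\<in>int_lattice. \<forall>y. norm y < e \<longrightarrow> e \<le> cmod (fourier (Ms j) (x + k + y))) \<and>
    (\<forall>y. norm y < e \<longrightarrow> e \<le> cmod (fourier (Ms j) y))"
proof -
  define P where "P x k e \<longleftrightarrow> k \<in> int_lattice \<and> e > 0 \<and> (\<forall>\<^sub>F j in sequentially.
      \<forall>u. norm (u - (x + k)) < e \<longrightarrow> e \<le> cmod (fourier (Ms j) u))" for x k e
  have "\<exists>k e. P x k e" for x
  proof -
    obtain k where "k \<in> int_lattice" "fourier M (x + k) \<noteq> 0"
      using Z unfolding periodic_zero_set_def by blast
    then show ?thesis
      using fourier_nonvanishing_near[OF Ms M w, of "x + k"] unfolding P_def by blast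
  qed
  then obtain k e where P: "\<And>x. P x (k x) (e x)" by metis
  then have k: "\<And>x. k x \<in> int_lattice" and e: "\<And>x. e x > 0"
    and near: "\<And>x. \<forall>\<^sub>F j in sequentially. \<forall>u. norm (u - (x + k x)) < e x \<longrightarrow> e x \<le> cmod (fourier (Ms j) u)"
    unfolding P_def by blast+
  \<comment> \<open>The origin is treated apart because there no integer shift is allowed;
    frequencies already chosen will rely on this.\<close>
  obtain e0 where e0: "e0 > 0"
    "\<forall>\<^sub>F j in sequentially. \<forall>u. norm (u - 0) < e0 \<longrightarrow> e0 \<le> cmod (fourier (Ms j) u)"
    using fourier_nonvanishing_near[OF Ms M w, of 0] fourier_0[OF M] by auto
  let ?Q = "cbox (0 :: real ^ 'n) 1"
  obtain D where D: "D \<subseteq> ?Q" "finite D" "?Q \<subseteq> (\<Union>x\<in>D. ball x (e x / 2))"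
  proof (rule compactE_image[OF compact_cbox, of ?Q "\<lambda>x. ball x (e x / 2)" 0 1])
    show "?Q \<subseteq> (\<Union>x\<in>?Q. ball x (e x / 2))"
      using e by (intro subsetI UN_I) (assumption, simp)
  qed auto
  \<comment> \<open>The covering balls use half of each radius; the other half absorbs the
    perturbation \<open>y\<close>.\<close>
  define \<epsilon> where "\<epsilon> = Min (insert e0 ((\<lambda>x. e x / 2) ` D))"
  have \<epsilon>: "\<epsilon> > 0" "\<epsilon> \<le> e0" "\<And>x. x \<in> D \<Longrightarrow> \<epsilon> \<le> e x / 2"
    unfolding \<epsilon>_def using D(2) e e0(1)
    by (auto simp: Min_gr_iff simp del: Min_insert le_divide_eq_numeral1 intro!: Min_le)
  have "\<forall>\<^sub>F j in sequentially. \<forall>x\<in>D. \<forall>u. norm (u - (x + k x)) < e x \<longrightarrow> e x \<le> cmod (fourier (Ms j) u)"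
    using D(2) near by (intro eventually_ball_finite) auto
  then have "\<forall>\<^sub>F j in sequentially.
    (\<forall>x. \<exists>k\<in>int_lattice. \<forall>y. norm y < \<epsilon> \<longrightarrow> \<epsilon> \<le> cmod (fourier (Ms j) (x + k + y))) \<and>
    (\<forall>y. norm y < \<epsilon> \<longrightarrow> \<epsilon> \<le> cmod (fourier (Ms j) y))"
    using e0(2)
  proof eventually_elim
    case (elim j)
    show ?case
    proof (intro conjI allI impI)
      show "\<epsilon> \<le> cmod (fourier (Ms j) y)" if "norm y < \<epsilon>" for y
        using elim(2)[rule_format, of y] that \<epsilon>(2) by simp
      fix x :: "real ^ 'n"
      \<comment> \<open>Removing the integer part moves \<open>x\<close> into the cube; the shift
        for \<open>x\<close> itself is then \<open>k z - f\<close>.\<close>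
      define f :: "real ^ 'n" where "f = (\<chi> i. of_int \<lfloor>x $ i\<rfloor>)"
      have f: "f \<in> int_lattice" by (simp add: f_def int_lattice_def)
      have "x - f \<in> ?Q"
        unfolding mem_box_cart f_def by (auto simp: of_int_floor_le) linarith
      then obtain z where z: "z \<in> D" "x - f \<in> ball z (e z / 2)" using D(3) by blast
      have "\<epsilon> \<le> cmod (fourier (Ms j) (x + (k z - f) + y))" if y: "norm y < \<epsilon>" for y
      proof -
        have "norm (x + (k z - f) + y - (z + k z)) = norm ((x - f - z) + y)"
          by (simp add: algebra_simps)
        also have "\<dots> \<le> norm (x - f - z) + norm y" by (rule norm_triangle_ineq)
        also have "\<dots> < e z"
          using z y \<epsilon>(3)[OF z(1)] by (simp add: dist_norm norm_minus_commute)
        finally have "e z \<le> cmod (fourier (Ms j) (x + (k z - f) + y))"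
          using elim(1) z(1) by blast
        then show ?thesis using \<epsilon>(3)[OF z(1)] e[of z] by linarith
      qed
      then show "\<exists>k\<in>int_lattice. \<forall>y. norm y < \<epsilon> \<longrightarrow> \<epsilon> \<le> cmod (fourier (Ms j) (x + k + y))"
        using int_lattice_diff[OF k f] by blast
    qed
  qed
  then show ?thesis using \<epsilon>(1) by blast
qed

section \<open>Masks of admissible pairs\<close>

lemma matrix_inv_mult:
  fixes A :: "real ^ 'n ^ 'n"
  assumes "invertible A"
  shows matrix_inv_right: "A ** matrix_inv A = mat 1"
    and matrix_inv_left: "matrix_inv A ** A = mat 1"
  using someI_ex[OF assms[unfolded invertible_def]] by (simp_all add: matrix_inv_def)

lemma matrix_inv_unique:
  fixes A C :: "real ^ 'n ^ 'n"
  assumes "A ** C = mat 1"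
  shows "matrix_inv A = C"
proof -
  have "invertible A" using assms by (auto simp: invertible_right_inverse)
  then have "matrix_inv A ** (A ** C) = C"
    by (simp add: matrix_mul_assoc matrix_inv_left)
  then show ?thesis by (simp add: assms)
qed

lemma matrix_inv_matrix_mul:
  fixes A C :: "real ^ 'n ^ 'n"
  assumes "invertible A" "invertible C"
  shows "matrix_inv (A ** C) = matrix_inv C ** matrix_inv A"
proof (rule matrix_inv_unique)
  have "A ** C ** (matrix_inv C ** matrix_inv A) = A ** (C ** matrix_inv C) ** matrix_inv A"
    by (simp add: matrix_mul_assoc)
  then show "A ** C ** (matrix_inv C ** matrix_inv A) = mat 1"
    using assms by (simp add: matrix_inv_right)
qed

text \<open>A nonzero kernel vector, read as a complex vector, would be an eigenvector for the
  eigenvalue 0.\<close>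

lemma expanding_imp_invertible:
  fixes A :: "real ^ 'n ^ 'n"
  assumes "expanding A"
  shows "invertible A"
proof (rule ccontr)
  assume "\<not> invertible A"
  then obtain x where x: "A *v x = 0" "x \<noteq> 0"
    unfolding invertible_left_inverse matrix_left_invertible_ker by blast
  define v :: "complex ^ 'n" where "v = (\<chi> i. complex_of_real (x $ i))"
  have "v \<noteq> 0" using x(2) by (auto simp: v_def vec_eq_iff)
  moreover have "((\<chi> i j. complex_of_real (A $ i $ j)) *v v) $ i = 0" for i
  proof -
    have "((\<chi> i j. complex_of_real (A $ i $ j)) *v v) $ i = complex_of_real ((A *v x) $ i)"
      by (simp add: matrix_vector_mult_def v_def)
    then show ?thesis by (simp add: x)
  qed
  then have "(\<chi> i j. complex_of_real (A $ i $ j)) *v v = 0 *s v"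
    by (simp add: vec_eq_iff)
  ultimately show False
    using assms unfolding expanding_def by fastforce
qed

lemma integer_matrix_mult:
  "integer_matrix A \<Longrightarrow> integer_matrix C \<Longrightarrow> integer_matrix (A ** C)"
  by (auto simp: integer_matrix_def matrix_matrix_mult_def intro!: Ints_sum Ints_mult)

lemma uminus_vector_matrix: "(- x) v* A = - (x v* (A :: real ^ 'n ^ 'm))"
  using vector_matrix_mult_diff_distrib[of 0 x A] by simp

lemma expo_matrix_vector: "expo \<xi> (A *v x) = expo (\<xi> v* A) x"
  by (simp add: expo_def dot_lmul_matrix)

lemma expo_int_lattice:
  assumes "k \<in> int_lattice" "x \<in> int_lattice"
  shows "expo k x = 1"
  using assms by (simp add: expo_def cis_multiple_2pi int_lattice_inner)

section \<open>Transforms of uniform measures and of convolutions\<close>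

lemma borel_prob_delta_set:
  assumes "finite A" "A \<noteq> {}"
  shows "borel_prob (delta_set A)"
proof -
  interpret prob_space "uniform_count_measure A"
    using assms by (rule prob_space_uniform_count_measure)
  show ?thesis unfolding borel_prob_def delta_set_def
    by (intro conjI prob_space_distr) (auto simp: measurable_def sets_uniform_count_measure space_uniform_count_measure)
qed

lemma fourier_delta_set:
  assumes "finite A" "A \<noteq> {}"
  shows "fourier (delta_set A) \<xi> = (\<Sum>a\<in>A. expo (- \<xi>) a) / of_nat (card A)"
proof -
  have "(\<lambda>x. x) \<in> uniform_count_measure A \<rightarrow>\<^sub>M borel"
    by (auto simp: measurable_def sets_uniform_count_measure space_uniform_count_measure)
  then have "fourier (delta_set A) \<xi> = integral\<^sup>L (uniform_count_measure A) (expo (- \<xi>))"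
    unfolding fourier_eq_expo delta_set_def by (subst integral_distr) auto
  also have "\<dots> = (\<Sum>a\<in>A. expo (- \<xi>) a / of_nat (card A))"
    using assms by (simp add: uniform_count_measure_def lebesgue_integral_point_measure_finite
        scaleR_conv_of_real divide_inverse mult.commute)
  finally show ?thesis by (simp add: sum_divide_distrib)
qed

lemma borel_prob_return: "borel_prob (return borel x)"
  by (simp add: borel_prob_def prob_space_return)

lemma conv_measurable:
  assumes "borel_prob M" "borel_prob N"
  shows "(\<lambda>(x, y). x + y) \<in> M \<Otimes>\<^sub>M N \<rightarrow>\<^sub>M (borel :: (real ^ 'n) measure)"
proof -
  have "sets (M \<Otimes>\<^sub>M N) = sets (borel \<Otimes>\<^sub>M borel)"
    using assms by (intro sets_pair_measure_cong) (auto simp: borel_prob_def)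
  then have "M \<Otimes>\<^sub>M N \<rightarrow>\<^sub>M borel = (borel \<Otimes>\<^sub>M borel) \<rightarrow>\<^sub>M (borel :: (real ^ 'n) measure)"
    by (rule measurable_cong_sets) simp
  then show ?thesis by simp
qed

lemma borel_prob_conv:
  assumes M: "borel_prob M" and N: "borel_prob N"
  shows "borel_prob (conv M N)"
proof -
  interpret M: prob_space M using M by (rule borel_prob_prob_space)
  interpret N: prob_space N using N by (rule borel_prob_prob_space)
  interpret P: pair_prob_space M N ..
  show ?thesis
    unfolding borel_prob_def conv_def using P.P.prob_space_distr[OF conv_measurable[OF M N]] by simp
qed

lemma fourier_conv:
  assumes M: "borel_prob M" and N: "borel_prob N"
  shows "fourier (conv M N) \<xi> = fourier M \<xi> * fourier N \<xi>"
proof -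
  interpret M: prob_space M using M by (rule borel_prob_prob_space)
  interpret N: prob_space N using N by (rule borel_prob_prob_space)
  interpret P: pair_prob_space M N ..
  have m: "(\<lambda>z. expo (- \<xi>) (case z of (x, y) \<Rightarrow> x + y)) \<in> borel_measurable (M \<Otimes>\<^sub>M N)"
    by (rule measurable_compose[OF conv_measurable[OF M N] expo_measurable])
  have e: "expo (- \<xi>) (x + y) = expo (- \<xi>) x * expo (- \<xi>) y" for x y
    by (simp add: expo_def inner_add_right cis_mult algebra_simps)
  have "fourier (conv M N) \<xi> = (\<integral>z. expo (- \<xi>) (case z of (x, y) \<Rightarrow> x + y) \<partial>(M \<Otimes>\<^sub>M N))"
    unfolding fourier_eq_expo conv_def
    by (rule integral_distr[OF conv_measurable[OF M N] expo_measurable])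
  also have "\<dots> = (\<integral>x. \<integral>y. expo (- \<xi>) (case (x, y) of (x, y) \<Rightarrow> x + y) \<partial>N \<partial>M)"
    by (rule P.integral_fst'[symmetric], rule P.P.integrable_const_bound[where B = 1]) (use m in auto)
  also have "\<dots> = (\<integral>x. \<integral>y. expo (- \<xi>) x * expo (- \<xi>) y \<partial>N \<partial>M)"
    by (simp add: e)
  also have "\<dots> = fourier M \<xi> * fourier N \<xi>"
    by (simp add: fourier_eq_expo)
  finally show ?thesis .
qed

text \<open>The transform of \<open>delta_set A\<close>, named separately so that each convolution
  factor becomes the mask of an integer digit set at a rescaled frequency.\<close>

definition mask :: "(real ^ 'n) set \<Rightarrow> real ^ 'n \<Rightarrow> complex" where
  "mask A \<eta> = (\<Sum>b\<in>A. expo (- \<eta>) b) / of_nat (card A)"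

lemma mask_periodic:
  assumes "A \<subseteq> int_lattice" "k \<in> int_lattice"
  shows "mask A (\<eta> + k) = mask A \<eta>"
proof -
  have "expo (- (\<eta> + k)) b = expo (- \<eta>) b" if "b \<in> A" for b
  proof -
    have "expo (- k) b = 1"
      using expo_int_lattice[of "0 - k" b] int_lattice_diff[OF int_lattice_0 assms(2)] that assms(1) by auto
    then show ?thesis using expo_add[of "- \<eta>" "- k" b] by simp
  qed
  then show ?thesis by (simp add: mask_def)
qed

text \<open>Up to the factor \<open>1 / sqrt N\<close>, the mask values are the coordinates of the
  image, under a unitary matrix, of a vector with \<open>N\<close> unimodular entries. The sum of
  their squared moduli is therefore 1.\<close>

lemma mask_sum_squares:
  assumes "admissible_pair A D"
  obtains L where "finite L" "L \<subseteq> int_lattice" "0 \<in> L"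
    "\<And>\<eta>. (\<Sum>l\<in>L. (cmod (mask D (\<eta> + l v* matrix_inv A)))\<^sup>2) = 1"
proof -
  define N where "N = card D"
  define W where "W b l = complex_of_real (1 / sqrt (real N)) * cis (- 2 * pi * ((matrix_inv A *v b) \<bullet> l))" for b l
  obtain L where D: "finite D" "D \<noteq> {}" and L: "finite L" "L \<subseteq> int_lattice" "card L = N"
    and rows: "\<And>b b'. b \<in> D \<Longrightarrow> b' \<in> D \<Longrightarrow> (\<Sum>l\<in>L. W b l * cnj (W b' l)) = (if b = b' then 1 else 0)"
    using assms unfolding admissible_pair_def Let_def W_def N_def by blast
  have N: "N > 0" using D by (simp add: N_def card_gt_0_iff)
  have W: "W b l = complex_of_real (1 / sqrt (real N)) * expo (- (l v* matrix_inv A)) b" for b l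
    by (simp add: W_def expo_def dot_lmul_matrix inner_commute[of _ l])
  have m: "mask D (\<eta> + l v* matrix_inv A) = (\<Sum>b\<in>D. expo (- \<eta>) b * W b l) / complex_of_real (sqrt (real N))" for \<eta> l
  proof -
    have "expo (- (\<eta> + l v* matrix_inv A)) b / of_nat N = expo (- \<eta>) b * W b l / complex_of_real (sqrt (real N))" for b
    proof -
      have "complex_of_real (sqrt (real N)) * complex_of_real (sqrt (real N)) = of_nat N"
        by (simp flip: of_real_mult)
      then show ?thesis
        using N expo_add[of "- \<eta>" "- (l v* matrix_inv A)" b] by (simp add: W field_simps)
    qed
    then show ?thesis unfolding mask_def N_def[symmetric] sum_divide_distrib by simp
  qed
  have s: "(\<Sum>l\<in>L. (cmod (mask D (\<eta> + l v* matrix_inv A)))\<^sup>2) = 1" for \<eta>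
  proof -
    have n: "complex_of_real ((cmod (mask D (\<eta> + l v* matrix_inv A)))\<^sup>2) =
        (\<Sum>b\<in>D. \<Sum>b'\<in>D. expo (- \<eta>) b * cnj (expo (- \<eta>) b') * (W b l * cnj (W b' l))) / of_nat N" for l
    proof -
      have "complex_of_real (sqrt (real N)) * complex_of_real (sqrt (real N)) = of_nat N"
        by (simp flip: of_real_mult)
      moreover have "(\<Sum>b\<in>D. expo (- \<eta>) b * W b l) * (\<Sum>b\<in>D. cnj (expo (- \<eta>) b) * cnj (W b l)) =
          (\<Sum>b\<in>D. \<Sum>b'\<in>D. expo (- \<eta>) b * cnj (expo (- \<eta>) b') * (W b l * cnj (W b' l)))"
        unfolding sum_product by (intro sum.cong refl) (simp add: mult_ac)
      ultimately show ?thesis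
        unfolding complex_norm_square m by simp
    qed
    have "complex_of_real (\<Sum>l\<in>L. (cmod (mask D (\<eta> + l v* matrix_inv A)))\<^sup>2) =
        (\<Sum>l\<in>L. \<Sum>b\<in>D. \<Sum>b'\<in>D. expo (- \<eta>) b * cnj (expo (- \<eta>) b') * (W b l * cnj (W b' l))) / of_nat N"
      unfolding of_real_sum n sum_divide_distrib ..
    also have "(\<Sum>l\<in>L. \<Sum>b\<in>D. \<Sum>b'\<in>D. expo (- \<eta>) b * cnj (expo (- \<eta>) b') * (W b l * cnj (W b' l))) =
        (\<Sum>b\<in>D. \<Sum>b'\<in>D. expo (- \<eta>) b * cnj (expo (- \<eta>) b') * (\<Sum>l\<in>L. W b l * cnj (W b' l)))"
      unfolding sum_distrib_left by (subst sum.swap, rule sum.cong[OF refl], rule sum.swap)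
    also have "\<dots> = (\<Sum>b\<in>D. \<Sum>b'\<in>D. if b = b' then 1 else 0)"
    proof (intro sum.cong refl)
      fix b b' assume "b \<in> D" "b' \<in> D"
      moreover have "expo (- \<eta>) b * cnj (expo (- \<eta>) b) = 1"
        using complex_norm_square[of "expo (- \<eta>) b"] by simp
      ultimately show "expo (- \<eta>) b * cnj (expo (- \<eta>) b') * (\<Sum>l\<in>L. W b l * cnj (W b' l)) = (if b = b' then 1 else 0)"
        by (auto simp: rows)
    qed
    also have "\<dots> = of_nat N" using D by (simp add: N_def)
    finally have "complex_of_real (\<Sum>l\<in>L. (cmod (mask D (\<eta> + l v* matrix_inv A)))\<^sup>2) = of_nat N / of_nat N" .
    also have "\<dots> = complex_of_real 1" using N by simp
    finally show ?thesis by (simp only: of_real_eq_iff)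
  qed
  \<comment> \<open>Subtracting one frequency brings 0 into the set; the identity holds for every
    \<open>\<eta>\<close>, which absorbs the translation.\<close>
  obtain l0 where l0: "l0 \<in> L" using L(3) N by (cases "L = {}") auto
  show ?thesis
  proof (rule that[of "(\<lambda>l. l - l0) ` L"])
    show "(\<lambda>l. l - l0) ` L \<subseteq> int_lattice" using L(2) l0 int_lattice_diff by blast
    show "0 \<in> (\<lambda>l. l - l0) ` L" using l0 by force
    show "(\<Sum>l\<in>(\<lambda>l. l - l0) ` L. (cmod (mask D (\<eta> + l v* matrix_inv A)))\<^sup>2) = 1" for \<eta>
      using s[of "\<eta> - l0 v* matrix_inv A"]
      by (subst sum.reindex) (auto simp: inj_on_def vector_matrix_mult_diff_distrib algebra_simps)
  qed (use L in auto)
qed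

section \<open>Spectra of the partial convolutions\<close>

text \<open>Equality in Bessel's inequality at every frequency characterizes a finite spectrum. In
  this form it passes easily through products and periodic shifts, and orthogonality follows from
  it.\<close>

definition tight_frame :: "(real ^ 'n) measure \<Rightarrow> (real ^ 'n) set \<Rightarrow> bool" where
  "tight_frame M \<Lambda> \<longleftrightarrow> finite \<Lambda> \<and> \<Lambda> \<subseteq> int_lattice \<and>
     (\<forall>\<xi>. (\<Sum>l\<in>\<Lambda>. (cmod (fourier M (\<xi> + l)))\<^sup>2) = 1)"

text \<open>At \<open>\<xi> = - g i\<close> the term of index \<open>i\<close> is already \<open>1\<close>, so all the others vanish.\<close>
lemma sum_squares_eq_1_orthogonal:
  assumes M: "borel_prob M" and I: "finite I"
    and s: "\<And>\<xi>. (\<Sum>i\<in>I. (cmod (fourier M (\<xi> + g i)))\<^sup>2) = 1"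
    and i: "i \<in> I" and j: "j \<in> I" "i \<noteq> j"
  shows "fourier M (g j - g i) = 0"
proof -
  have "1 = (cmod (fourier M (- g i + g i)))\<^sup>2 + (\<Sum>j\<in>I - {i}. (cmod (fourier M (- g i + g j)))\<^sup>2)"
    using s[of "- g i"] I i by (simp add: sum.remove[of I i])
  then have "(\<Sum>j\<in>I - {i}. (cmod (fourier M (- g i + g j)))\<^sup>2) = 0"
    using fourier_0[OF M] by simp
  then have "(cmod (fourier M (- g i + g j)))\<^sup>2 = 0"
    using I j by (subst (asm) sum_nonneg_eq_0_iff) auto
  then show ?thesis by simp
qed

text \<open>Two indices with the same frequency would force the transform to vanish at 0, where it
  is 1. So the indexed sum is a sum over the image.\<close>

lemma tight_frame_image:
  assumes M: "borel_prob M" and I: "finite I" and g: "\<And>i. i \<in> I \<Longrightarrow> g i \<in> int_lattice"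
    and s: "\<And>\<xi>. (\<Sum>i\<in>I. (cmod (fourier M (\<xi> + g i)))\<^sup>2) = 1"
  shows "tight_frame M (g ` I)"
proof -
  have "inj_on g I"
  proof (rule inj_onI, rule ccontr)
    fix i j assume "i \<in> I" "j \<in> I" "g i = g j" "i \<noteq> j"
    then show False
      using sum_squares_eq_1_orthogonal[OF M I s, of i j] fourier_0[OF M] by simp
  qed
  then show ?thesis
    using I g s by (auto simp: tight_frame_def sum.reindex)
qed

lemma tight_frame_orthogonal:
  assumes "borel_prob M" "tight_frame M \<Lambda>" "l \<in> \<Lambda>" "l' \<in> \<Lambda>" "l \<noteq> l'"
  shows "fourier M (l - l') = 0"
  using sum_squares_eq_1_orthogonal[of M \<Lambda> "\<lambda>l. l" l' l] assms by (simp add: tight_frame_def)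

lemma fourier_conv_seq_0: "fourier (conv_seq F 0) \<xi> = 1"
  using integral_return[of 0 borel "expo (- \<xi>)"] by (simp add: fourier_eq_expo expo_def)

section \<open>Transforms of partial convolutions and their tails\<close>

locale admissible_sequence =
  fixes R :: "nat \<Rightarrow> real ^ 'n ^ 'n" and B :: "nat \<Rightarrow> (real ^ 'n) set"
  assumes admissible: "\<And>n. n \<ge> 1 \<Longrightarrow> admissible_pair (R n) (B n)"
begin

abbreviation P :: "nat \<Rightarrow> real ^ 'n ^ 'n" where "P \<equiv> matprod R 0"

text \<open>Frequencies are treated as row vectors, so \<open>\<xi> v* Q n\<close> is the inverse
  transpose of \<open>P n\<close> applied to \<open>\<xi>\<close>.\<close>

abbreviation Q :: "nat \<Rightarrow> real ^ 'n ^ 'n" where "Q n \<equiv> matrix_inv (P n)"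

abbreviation \<mu>\<^sub>f :: "nat \<Rightarrow> (real ^ 'n) measure" where "\<mu>\<^sub>f \<equiv> conv_seq (factor R B 0)"

lemma matprod_invertible: "invertible (matprod R m k)"
proof (induction k)
  case 0
  show ?case unfolding invertible_def by (auto intro!: exI[of _ "mat 1"])
next
  case (Suc k)
  then show ?case
    using admissible[of "m + Suc k"]
    by (auto simp: admissible_pair_def intro: invertible_mult expanding_imp_invertible)
qed

lemma P_integer: "integer_matrix (P n)"
proof (induction n)
  case 0
  show ?case by (auto simp: integer_matrix_def mat_def)
next
  case (Suc n)
  then show ?case
    using admissible[of "Suc n"] by (auto simp: admissible_pair_def intro: integer_matrix_mult)
qed

lemma vector_P_Q: "(x v* P n) v* Q n = x"
  by (simp add: vector_matrix_mul_assoc matrix_inv_right[OF matprod_invertible])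

lemma matprod_split: "P (n + k) = matprod R n k ** P n"
  by (induction k) (simp_all add: matrix_mul_assoc)

lemma Q_split: "Q (n + k) = Q n ** matrix_inv (matprod R n k)"
  unfolding matprod_split by (intro matrix_inv_matrix_mul matprod_invertible)

lemma Q_Suc: "Q (Suc n) = Q n ** matrix_inv (R (Suc n))"
  using Q_split[of n 1] by simp

text \<open>Carries the decay hypothesis on the products of inverses over to the matrices that
  rescale frequencies.\<close>

lemma invprod_eq: "invprod R n = Q n"
proof (induction n)
  case 0
  then show ?case using matrix_inv_unique[of "mat 1 :: real ^ 'n ^ 'n" "mat 1"] by simp
next
  case (Suc n)
  then show ?case by (simp add: Q_Suc del: matprod.simps)
qed

lemma B_props:
  assumes "n \<ge> 1"
  shows "finite (B n)" "B n \<noteq> {}" "B n \<subseteq> int_lattice"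
  using admissible[OF assms] by (auto simp: admissible_pair_def)

lemma borel_prob_factor: "m + k \<ge> 1 \<Longrightarrow> borel_prob (factor R B m k)"
  unfolding factor_def using B_props by (intro borel_prob_delta_set) auto

lemma borel_prob_conv_seq: "borel_prob (conv_seq (factor R B m) k)"
  by (induction k) (auto intro!: borel_prob_conv borel_prob_factor borel_prob_return)

lemma fourier_factor:
  assumes "m + k \<ge> 1"
  shows "fourier (factor R B m k) \<xi> = mask (B (m + k)) (\<xi> v* matrix_inv (matprod R m k))"
proof -
  let ?A = "matrix_inv (matprod R m k)"
  \<comment> \<open>Injectivity ensures that no atoms merge, so the normalization by the number of
    digits is unchanged.\<close>
  have inj: "inj_on (\<lambda>b. ?A *v b) (B (m + k))"
  proof (rule inj_on_inverseI)
    show "matprod R m k *v (?A *v b) = b" for b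
      by (simp add: matrix_vector_mul_assoc matrix_inv_right[OF matprod_invertible])
  qed
  show ?thesis
    unfolding factor_def mask_def using B_props[OF assms] inj
    by (simp add: fourier_delta_set sum.reindex card_image expo_matrix_vector uminus_vector_matrix)
qed

lemma fourier_conv_seq_Suc:
  "fourier (conv_seq (factor R B m) (Suc k)) \<xi> =
     fourier (conv_seq (factor R B m) k) \<xi> * mask (B (m + Suc k)) (\<xi> v* matrix_inv (matprod R m (Suc k)))"
  using fourier_conv[OF borel_prob_conv_seq borel_prob_factor, of m "Suc k"]
  by (simp add: fourier_factor del: matprod.simps)

text \<open>Since \<open>Q (n + k)\<close> factors through \<open>Q n\<close>, the masks beyond
  level \<open>n\<close> are those of the tail, evaluated at \<open>\<xi> v* Q n\<close>.\<close>

lemma fourier_conv_seq_split: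
  "fourier (\<mu>\<^sub>f (n + k)) \<xi> = fourier (\<mu>\<^sub>f n) \<xi> * fourier (conv_seq (factor R B n) k) (\<xi> v* Q n)"
proof (induction k)
  case 0
  then show ?case by (simp add: fourier_conv_seq_0 del: conv_seq.simps)
next
  case (Suc k)
  have "fourier (\<mu>\<^sub>f (n + Suc k)) \<xi> = fourier (\<mu>\<^sub>f (n + k)) \<xi> * mask (B (n + Suc k)) (\<xi> v* Q (n + Suc k))"
    using fourier_conv_seq_Suc[of 0 "n + k" \<xi>] by (simp del: matprod.simps conv_seq.simps)
  then show ?case
    unfolding fourier_conv_seq_Suc[of n k] Suc Q_split[of n "Suc k"] vector_matrix_mul_assoc
    by (simp only: mult.assoc)
qed

lemma fourier_limit_split:
  assumes \<mu>: "borel_prob \<mu>" "weak_conv_to \<mu>\<^sub>f \<mu>"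
    and \<tau>: "borel_prob \<tau>" "weak_conv_to (conv_seq (factor R B n)) \<tau>"
  shows "fourier \<mu> \<xi> = fourier (\<mu>\<^sub>f n) \<xi> * fourier \<tau> (\<xi> v* Q n)"
proof (rule LIMSEQ_unique)
  show "(\<lambda>k. fourier (\<mu>\<^sub>f (k + n)) \<xi>) \<longlonglongrightarrow> fourier \<mu> \<xi>"
    by (rule LIMSEQ_ignore_initial_segment) (rule weak_conv_to_fourier[OF borel_prob_conv_seq \<mu>])
  show "(\<lambda>k. fourier (\<mu>\<^sub>f (k + n)) \<xi>) \<longlonglongrightarrow> fourier (\<mu>\<^sub>f n) \<xi> * fourier \<tau> (\<xi> v* Q n)"
    unfolding add.commute[of _ n] fourier_conv_seq_split
    by (intro tendsto_mult tendsto_const weak_conv_to_fourier[OF borel_prob_conv_seq \<tau>])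
qed

text \<open>At the last level the mask argument moves by the integer vector \<open>k\<close>; for
  the earlier levels the same shift is a period with \<open>k v* R (Suc n)\<close> in place of
  \<open>k\<close>, which is why \<open>k\<close> is generalized in the induction.\<close>

lemma fourier_conv_seq_periodic:
  assumes "k \<in> int_lattice"
  shows "fourier (\<mu>\<^sub>f n) (\<xi> + k v* P n) = fourier (\<mu>\<^sub>f n) \<xi>"
  using assms
proof (induction n arbitrary: k)
  case 0
  then show ?case by (simp only: fourier_conv_seq_0)
next
  case (Suc n)
  have "k v* R (Suc n) \<in> int_lattice"
    using Suc.prems admissible[of "Suc n"] by (auto simp: admissible_pair_def intro: int_lattice_vector_matrix)
  then have 1: "fourier (\<mu>\<^sub>f n) (\<xi> + k v* P (Suc n)) = fourier (\<mu>\<^sub>f n) \<xi>"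
    using Suc.IH[of "k v* R (Suc n)"] by (simp add: vector_matrix_mul_assoc)
  have 2: "(\<xi> + k v* P (Suc n)) v* Q (Suc n) = \<xi> v* Q (Suc n) + k"
    by (simp only: vector_matrix_left_distrib vector_P_Q)
  show ?case
    unfolding fourier_conv_seq_Suc 1 add_0 2
    by (subst mask_periodic) (use Suc.prems B_props[of "Suc n"] in auto)
qed

section \<open>Extending and shifting finite spectra\<close>

lemma tight_frame_0: "tight_frame (\<mu>\<^sub>f 0) {0}"
  unfolding tight_frame_def using fourier_conv_seq_0[of "factor R B 0"] by simp

text \<open>The new frequencies are \<open>a + l v* P n\<close>. The transform at level
  \<open>n\<close> ignores the period \<open>l v* P n\<close>, and the squared masks sum to 1 over
  \<open>l\<close>. The choice \<open>l = 0\<close> retains the old frequencies.\<close>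

lemma tight_frame_Suc:
  assumes \<Lambda>: "tight_frame (\<mu>\<^sub>f n) \<Lambda>"
  obtains \<Lambda>' where "\<Lambda> \<subseteq> \<Lambda>'" "tight_frame (\<mu>\<^sub>f (Suc n)) \<Lambda>'"
proof -
  obtain L where L: "finite L" "L \<subseteq> int_lattice" "0 \<in> L"
    "\<And>\<eta>. (\<Sum>l\<in>L. (cmod (mask (B (Suc n)) (\<eta> + l v* matrix_inv (R (Suc n)))))\<^sup>2) = 1"
    using mask_sum_squares[OF admissible[of "Suc n"]] by auto
  let ?g = "\<lambda>(a, l). a + l v* P n"
  have PQ: "(x v* P n) v* Q (Suc n) = x v* matrix_inv (R (Suc n))" for x
    unfolding Q_Suc vector_matrix_mul_assoc[symmetric] vector_P_Q ..
  have f: "fourier (\<mu>\<^sub>f (Suc n)) (\<xi> + (a + l v* P n)) =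
      fourier (\<mu>\<^sub>f n) (\<xi> + a) * mask (B (Suc n)) ((\<xi> + a) v* Q (Suc n) + l v* matrix_inv (R (Suc n)))"
    if "l \<in> L" for \<xi> a l
  proof -
    have "fourier (\<mu>\<^sub>f n) ((\<xi> + a) + l v* P n) = fourier (\<mu>\<^sub>f n) (\<xi> + a)"
      using that L(2) by (intro fourier_conv_seq_periodic) auto
    then show ?thesis
      unfolding fourier_conv_seq_Suc add_0 add.assoc[symmetric, of \<xi> a "l v* P n"]
        vector_matrix_left_distrib[of "\<xi> + a" "l v* P n"] PQ by simp
  qed
  have "tight_frame (\<mu>\<^sub>f (Suc n)) (?g ` (\<Lambda> \<times> L))"
  proof (rule tight_frame_image[OF borel_prob_conv_seq])
    show "finite (\<Lambda> \<times> L)" using \<Lambda> L by (simp add: tight_frame_def)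
    show "?g i \<in> int_lattice" if "i \<in> \<Lambda> \<times> L" for i
      using that \<Lambda> L(2) int_lattice_vector_matrix[OF _ P_integer[of n]]
      by (auto simp: tight_frame_def intro!: int_lattice_add)
    fix \<xi>
    have "(\<Sum>i\<in>\<Lambda> \<times> L. (cmod (fourier (\<mu>\<^sub>f (Suc n)) (\<xi> + ?g i)))\<^sup>2) =
        (\<Sum>a\<in>\<Lambda>. \<Sum>l\<in>L. (cmod (fourier (\<mu>\<^sub>f (Suc n)) (\<xi> + (a + l v* P n))))\<^sup>2)"
      by (simp add: sum.cartesian_product case_prod_beta del: conv_seq.simps)
    also have "\<dots> = (\<Sum>a\<in>\<Lambda>. (cmod (fourier (\<mu>\<^sub>f n) (\<xi> + a)))\<^sup>2)"
    proof (rule sum.cong[OF refl])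
      fix a
      have "(\<Sum>l\<in>L. (cmod (fourier (\<mu>\<^sub>f (Suc n)) (\<xi> + (a + l v* P n))))\<^sup>2) =
        (\<Sum>l\<in>L. (cmod (fourier (\<mu>\<^sub>f n) (\<xi> + a)))\<^sup>2 *
          (cmod (mask (B (Suc n)) ((\<xi> + a) v* Q (Suc n) + l v* matrix_inv (R (Suc n)))))\<^sup>2)"
        by (rule sum.cong[OF refl]) (simp only: f norm_mult power_mult_distrib)
      also have "\<dots> = (cmod (fourier (\<mu>\<^sub>f n) (\<xi> + a)))\<^sup>2"
        unfolding sum_distrib_left[symmetric] L(4) by simp
      finally show "(\<Sum>l\<in>L. (cmod (fourier (\<mu>\<^sub>f (Suc n)) (\<xi> + (a + l v* P n))))\<^sup>2) = \<dots>" .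
    qed
    also have "\<dots> = 1" using \<Lambda> by (simp add: tight_frame_def)
    finally show "(\<Sum>i\<in>\<Lambda> \<times> L. (cmod (fourier (\<mu>\<^sub>f (Suc n)) (\<xi> + ?g i)))\<^sup>2) = 1" .
  qed
  moreover have "\<Lambda> \<subseteq> ?g ` (\<Lambda> \<times> L)"
    using L(3) by (force simp: image_iff)
  ultimately show ?thesis by (rule that[rotated])
qed

lemma tight_frame_extend:
  assumes "tight_frame (\<mu>\<^sub>f n) \<Lambda>" "n \<le> m"
  shows "\<exists>\<Lambda>'. \<Lambda> \<subseteq> \<Lambda>' \<and> tight_frame (\<mu>\<^sub>f m) \<Lambda>'"
  using assms(2)
proof (induction rule: dec_induct)
  case base
  then show ?case using assms(1) by blast
next
  case (step m)
  then obtain \<Lambda>' where "\<Lambda> \<subseteq> \<Lambda>'" "tight_frame (\<mu>\<^sub>f m) \<Lambda>'" by blast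
  then show ?case using tight_frame_Suc by (metis order_trans)
qed

lemma tight_frame_shift:
  assumes \<Lambda>: "tight_frame (\<mu>\<^sub>f n) \<Lambda>" and k: "\<And>l. k l \<in> int_lattice"
  shows "tight_frame (\<mu>\<^sub>f n) ((\<lambda>l. l + k l v* P n) ` \<Lambda>)"
proof (rule tight_frame_image[OF borel_prob_conv_seq])
  show "finite \<Lambda>" using \<Lambda> by (simp add: tight_frame_def)
  show "l + k l v* P n \<in> int_lattice" if "l \<in> \<Lambda>" for l
    using that \<Lambda> k int_lattice_vector_matrix[OF k P_integer[of n]]
    by (auto simp: tight_frame_def intro!: int_lattice_add)
  show "(\<Sum>l\<in>\<Lambda>. (cmod (fourier (\<mu>\<^sub>f n) (\<xi> + (l + k l v* P n))))\<^sup>2) = 1" for \<xi>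
    using \<Lambda> unfolding add.assoc[symmetric] fourier_conv_seq_periodic[OF k] by (simp add: tight_frame_def)
qed

lemma vector_Q_tendsto_0:
  assumes "(\<lambda>n. norm (invprod R n)) \<longlonglongrightarrow> 0"
  shows "(\<lambda>n. \<xi> v* Q n) \<longlonglongrightarrow> 0"
proof (rule vec_tendstoI)
  fix i
  have "(\<lambda>n. Q n) \<longlonglongrightarrow> 0"
    using assms unfolding invprod_eq by (rule tendsto_norm_zero_cancel)
  then have "(\<lambda>n. Q n $ j $ i) \<longlonglongrightarrow> 0 $ j $ i" for j
    by (intro tendsto_vec_nth)
  then have "(\<lambda>n. \<Sum>j\<in>UNIV. \<xi> $ j * Q n $ j $ i) \<longlonglongrightarrow> (\<Sum>j\<in>UNIV. \<xi> $ j * 0)"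
    by (intro tendsto_sum tendsto_mult tendsto_const) simp
  then show "(\<lambda>n. (\<xi> v* Q n) $ i) \<longlonglongrightarrow> 0 $ i"
    by (simp add: vector_matrix_mult_def)
qed

end

section \<open>Nested spectra avoiding the zeros of the tails\<close>

context admissible_sequence
begin

text \<open>The perturbation \<open>y\<close> leaves room for \<open>\<xi> v* Q m\<close>, so one
  choice of frequencies serves every \<open>\<xi>\<close> once \<open>m\<close> is large. The same
  \<open>e\<close> is radius and lower bound.\<close>

definition nonvanishing_at ::
    "(nat \<Rightarrow> (real ^ 'n) measure) \<Rightarrow> real \<Rightarrow> nat \<Rightarrow> (real ^ 'n) set \<Rightarrow> bool" where
  "nonvanishing_at \<tau> e m \<Lambda> \<longleftrightarrow>
     (\<forall>l\<in>\<Lambda>. \<forall>y. norm y < e \<longrightarrow> e \<le> cmod (fourier (\<tau> m) (l v* Q m + y)))"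

text \<open>Old frequencies are kept, since \<open>l v* Q m\<close> is close to \<open>0\<close> for them; new ones are
  moved by a period of \<open>\<mu>\<^sub>f m\<close> to where the tail does not vanish.\<close>
lemma tight_frame_step:
  assumes norm0: "(\<lambda>n. norm (invprod R n)) \<longlonglongrightarrow> 0" and e: "e > 0" and nj: "strict_mono nj"
    and nv: "\<forall>\<^sub>F j in sequentially.
      (\<forall>x. \<exists>k\<in>int_lattice. \<forall>y. norm y < e \<longrightarrow> e \<le> cmod (fourier (\<tau> (nj j)) (x + k + y))) \<and>
      (\<forall>y. norm y < e \<longrightarrow> e \<le> cmod (fourier (\<tau> (nj j)) y))"
    and \<Lambda>: "tight_frame (\<mu>\<^sub>f n) \<Lambda>"
  shows "\<exists>m \<Lambda>'. n < m \<and> \<Lambda> \<subseteq> \<Lambda>' \<and> tight_frame (\<mu>\<^sub>f m) \<Lambda>' \<and> nonvanishing_at \<tau> (e / 2) m \<Lambda>'"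
proof -
  have lim: "filterlim nj at_top sequentially" by (rule filterlim_subseq[OF nj])
  have "\<forall>\<^sub>F j in sequentially. norm (l v* Q (nj j)) < e / 2" for l
    using filterlim_compose[OF tendsto_norm_zero[OF vector_Q_tendsto_0[OF norm0, of l]] lim] e
    by (intro order_tendstoD(2)) auto
  then have "\<forall>\<^sub>F j in sequentially. \<forall>l\<in>\<Lambda>. norm (l v* Q (nj j)) < e / 2"
    using \<Lambda> by (intro eventually_ball_finite) (auto simp: tight_frame_def)
  moreover have "\<forall>\<^sub>F j in sequentially. n < nj j"
    using lim eventually_gt_at_top[of n] unfolding filterlim_iff by blast
  ultimately have "\<forall>\<^sub>F j in sequentially. \<exists>m. n < m \<and> (\<forall>l\<in>\<Lambda>. norm (l v* Q m) < e / 2) \<and>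
      (\<forall>x. \<exists>k\<in>int_lattice. \<forall>y. norm y < e \<longrightarrow> e \<le> cmod (fourier (\<tau> m) (x + k + y))) \<and>
      (\<forall>y. norm y < e \<longrightarrow> e \<le> cmod (fourier (\<tau> m) y))"
    using nv by eventually_elim blast
  then obtain m where m: "n < m" and small: "\<And>l. l \<in> \<Lambda> \<Longrightarrow> norm (l v* Q m) < e / 2"
    and near: "\<And>x. \<exists>k\<in>int_lattice. \<forall>y. norm y < e \<longrightarrow> e \<le> cmod (fourier (\<tau> m) (x + k + y))"
    and near0: "\<And>y. norm y < e \<Longrightarrow> e \<le> cmod (fourier (\<tau> m) y)"
    using eventually_happens'[OF sequentially_bot] by blast
  obtain \<Lambda>1 where \<Lambda>1: "\<Lambda> \<subseteq> \<Lambda>1" "tight_frame (\<mu>\<^sub>f m) \<Lambda>1"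
    using tight_frame_extend[OF \<Lambda>, of m] m by auto
  obtain k0 where k0: "\<And>x. k0 x \<in> int_lattice"
    "\<And>x y. norm y < e \<Longrightarrow> e \<le> cmod (fourier (\<tau> m) (x + k0 x + y))"
    using near by metis
  \<comment> \<open>Shift 0 on \<open>\<Lambda>\<close> gives nestedness. There
    \<open>l v* Q m\<close> and \<open>y\<close> each have norm below \<open>e / 2\<close>, so their
    sum stays within the safe ball about 0.\<close>
  define k where "k l = (if l \<in> \<Lambda> then 0 else k0 (l v* Q m))" for l
  define \<Lambda>' where "\<Lambda>' = (\<lambda>l. l + k l v* P m) ` \<Lambda>1"
  have "tight_frame (\<mu>\<^sub>f m) \<Lambda>'"
    unfolding \<Lambda>'_def by (rule tight_frame_shift[OF \<Lambda>1(2)]) (simp add: k_def k0)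
  moreover have "\<Lambda> \<subseteq> \<Lambda>'"
    using \<Lambda>1(1) by (force simp: \<Lambda>'_def k_def image_iff)
  moreover have "nonvanishing_at \<tau> (e / 2) m \<Lambda>'"
    unfolding nonvanishing_at_def \<Lambda>'_def
  proof (intro ballI allI impI)
    fix l' y :: "real ^ 'n" assume "l' \<in> (\<lambda>l. l + k l v* P m) ` \<Lambda>1" and y: "norm y < e / 2"
    then obtain l where l: "l' = l + k l v* P m" by blast
    have l'Q: "l' v* Q m = l v* Q m + k l"
      unfolding l vector_matrix_left_distrib vector_P_Q ..
    have "e \<le> cmod (fourier (\<tau> m) (l' v* Q m + y))"
    proof (cases "l \<in> \<Lambda>")
      case True
      have "norm (l v* Q m + y) < e"
        using norm_triangle_ineq[of "l v* Q m" y] small[OF True] y by linarith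
      then show ?thesis using near0 True by (simp add: l'Q k_def)
    next
      case False
      then show ?thesis using k0(2)[of y "l v* Q m"] y e by (simp add: l'Q k_def)
    qed
    then show "e / 2 \<le> cmod (fourier (\<tau> m) (l' v* Q m + y))" using e by linarith
  qed
  ultimately show ?thesis using m by blast
qed

lemma frame_sequence:
  assumes norm0: "(\<lambda>n. norm (invprod R n)) \<longlonglongrightarrow> 0" and e: "e > 0" and nj: "strict_mono nj"
    and nv: "\<forall>\<^sub>F j in sequentially.
      (\<forall>x. \<exists>k\<in>int_lattice. \<forall>y. norm y < e \<longrightarrow> e \<le> cmod (fourier (\<tau> (nj j)) (x + k + y))) \<and>
      (\<forall>y. norm y < e \<longrightarrow> e \<le> cmod (fourier (\<tau> (nj j)) y))"
  obtains m \<Lambda> where "strict_mono m" "\<And>i. m i \<ge> (1::nat)" "incseq \<Lambda>"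
    "\<And>i. tight_frame (\<mu>\<^sub>f (m i)) (\<Lambda> i)" "\<And>i. nonvanishing_at \<tau> (e / 2) (m i) (\<Lambda> i)"
proof -
  note step = tight_frame_step[OF norm0 e nj nv]
  define G where "G = (\<lambda>(m, \<Lambda>). 1 \<le> m \<and> tight_frame (\<mu>\<^sub>f m) \<Lambda> \<and> nonvanishing_at \<tau> (e / 2) m \<Lambda>)"
  have "\<exists>h. \<forall>i. G (h i) \<and> fst (h i) < fst (h (Suc i)) \<and> snd (h i) \<subseteq> snd (h (Suc i))"
  \<comment> \<open>Level and frequency set are chosen together as a pair. The first pair comes from
    one step beyond the trivial frame \<open>{0}\<close> at level 0, so every level is at least
    1.\<close>
  proof (rule dependent_nat_choice[where P = "\<lambda>_. G"
        and Q = "\<lambda>_ x y. fst x < fst y \<and> snd x \<subseteq> snd y"])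
    obtain m \<Lambda>' where "0 < m" "tight_frame (\<mu>\<^sub>f m) \<Lambda>'" "nonvanishing_at \<tau> (e / 2) m \<Lambda>'"
      using step[OF tight_frame_0] by blast
    then show "\<exists>x. G x" by (intro exI[of _ "(m, \<Lambda>')"]) (simp add: G_def)
    fix x i assume "G x"
    then have "1 \<le> fst x" "tight_frame (\<mu>\<^sub>f (fst x)) (snd x)" by (auto simp: G_def split: prod.splits)
    then obtain m \<Lambda>' where "fst x < m" "snd x \<subseteq> \<Lambda>'" "tight_frame (\<mu>\<^sub>f m) \<Lambda>'"
      "nonvanishing_at \<tau> (e / 2) m \<Lambda>'" using step by blast
    then show "\<exists>y. G y \<and> fst x < fst y \<and> snd x \<subseteq> snd y"
      by (intro exI[of _ "(m, \<Lambda>')"]) (auto simp: G_def)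
  qed
  then obtain h where h: "\<And>i. G (h i)" "\<And>i. fst (h i) < fst (h (Suc i))" "\<And>i. snd (h i) \<subseteq> snd (h (Suc i))"
    by blast
  show ?thesis
  proof (rule that[of "\<lambda>i. fst (h i)" "\<lambda>i. snd (h i)"])
    show "strict_mono (\<lambda>i. fst (h i))" using h(2) by (simp add: strict_mono_Suc_iff)
    show "incseq (\<lambda>i. snd (h i))" using h(3) by (rule incseq_SucI)
  qed (use h(1) in \<open>simp_all add: G_def case_prod_beta\<close>)
qed

text \<open>Mass could escape to ever larger frequencies in the limit. The lower bound
  \<open>e\<close> on the tails prevents this: outside a finite set, the sum for the partial
  convolution is at most \<open>1 / e\<^sup>2\<close> times the sum for \<open>\<mu>\<close>,
  eventually along the sequence.\<close>

lemma frame_sequence_complete: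
  assumes \<mu>: "borel_prob \<mu>" "weak_conv_to \<mu>\<^sub>f \<mu>"
    and norm0: "(\<lambda>n. norm (invprod R n)) \<longlonglongrightarrow> 0" and e: "e > 0"
    and tails: "\<And>n. n \<ge> 1 \<Longrightarrow> borel_prob (\<tau> n) \<and> weak_conv_to (conv_seq (factor R B n)) (\<tau> n)"
    and m: "strict_mono m" "\<And>i. m i \<ge> 1" and \<Lambda>: "incseq \<Lambda>"
    and tight: "\<And>i. tight_frame (\<mu>\<^sub>f (m i)) (\<Lambda> i)"
    and nv: "\<And>i. nonvanishing_at \<tau> e (m i) (\<Lambda> i)"
  shows "spectrum_of \<mu> (\<Union>i. \<Lambda> i)"
proof (rule spectrum_ofI[OF \<mu>(1)])
  have split: "fourier \<mu> \<xi> = fourier (\<mu>\<^sub>f (m i)) \<xi> * fourier (\<tau> (m i)) (\<xi> v* Q (m i))" for i \<xi>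
    using fourier_limit_split[OF \<mu>] tails[OF m(2)] by blast
  have fin: "finite (\<Lambda> i)" for i using tight by (simp add: tight_frame_def)
  then show "countable (\<Union>i. \<Lambda> i)" by (auto intro: countable_finite)
  show orth: "fourier \<mu> (l - l') = 0" if l: "l \<in> (\<Union>i. \<Lambda> i)" "l' \<in> (\<Union>i. \<Lambda> i)" "l \<noteq> l'" for l l'
  proof -
    from l obtain i i' where "l \<in> \<Lambda> i" "l' \<in> \<Lambda> i'" by blast
    then have "l \<in> \<Lambda> (max i i')" "l' \<in> \<Lambda> (max i i')"
      using incseqD[OF \<Lambda>, of i "max i i'"] incseqD[OF \<Lambda>, of i' "max i i'"] by auto
    then show ?thesis
      using tight_frame_orthogonal[OF borel_prob_conv_seq tight[of "max i i'"] _ _ l(3)]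
        split[of "l - l'" "max i i'"] by simp
  qed
  fix \<xi> :: "real ^ 'n" and \<delta> :: real assume \<delta>: "\<delta> > 0"
  define S where "S F = (\<Sum>l\<in>F. (cmod (fourier \<mu> (\<xi> + l)))\<^sup>2)" for F
  let ?X = "{F. finite F \<and> F \<subseteq> (\<Union>i. \<Lambda> i)}"
  \<comment> \<open>Orthogonality and Bessel's inequality bound all finite sums by 1, so the
    supremum below is meaningful.\<close>
  have bdd: "bdd_above (S ` ?X)"
  proof (rule bdd_aboveI2)
    show "S F \<le> 1" if "F \<in> ?X" for F
      unfolding S_def using that by (intro bessel_fourier[OF \<mu>(1)] orth) auto
  qed
  define s where "s = Sup (S ` ?X)"
  \<comment> \<open>A finite set this close to the supremum leaves less than
    \<open>\<delta> * e\<^sup>2\<close> for all other frequencies; the factor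
    \<open>e\<^sup>2\<close> cancels in the comparison with the partial convolutions.\<close>
  have "\<exists>r\<in>S ` ?X. s - \<delta> * e\<^sup>2 < r"
  proof (rule less_cSupD)
    show "s - \<delta> * e\<^sup>2 < Sup (S ` ?X)" using \<delta> e by (simp add: s_def)
  qed blast
  then obtain F where F: "finite F" "F \<subseteq> (\<Union>i. \<Lambda> i)" "s - \<delta> * e\<^sup>2 < S F" by blast
  have F_max: "S F' - S F \<le> \<delta> * e\<^sup>2" if "finite F'" "F' \<subseteq> (\<Union>i. \<Lambda> i)" for F'
  proof -
    have "S F' \<le> s" unfolding s_def using that by (intro cSup_upper[OF _ bdd] imageI) simp
    then show ?thesis using F(3) by linarith
  qed
  have mlim: "filterlim m at_top sequentially" by (rule filterlim_subseq[OF m(1)])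
  have sub: "\<forall>\<^sub>F i in sequentially. F \<subseteq> \<Lambda> i"
  proof -
    have "\<forall>\<^sub>F i in sequentially. l \<in> \<Lambda> i" if "l \<in> F" for l
    proof -
      obtain i where "l \<in> \<Lambda> i" using F(2) \<open>l \<in> F\<close> by blast
      then show ?thesis
        unfolding eventually_sequentially using incseqD[OF \<Lambda>] by blast
    qed
    then show ?thesis
      unfolding subset_eq using F(1) by (intro eventually_ball_finite) auto
  qed
  have small: "\<forall>\<^sub>F i in sequentially. norm (\<xi> v* Q (m i)) < e"
    using filterlim_compose[OF tendsto_norm_zero[OF vector_Q_tendsto_0[OF norm0, of \<xi>]] mlim] e
    by (intro order_tendstoD(2)) auto
  define T where "T i = (\<Sum>l\<in>F. (cmod (fourier (\<mu>\<^sub>f (m i)) (\<xi> + l)))\<^sup>2)" for i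
  have ev: "\<forall>\<^sub>F i in sequentially. 1 - \<delta> \<le> T i"
    using sub small
  proof eventually_elim
    case (elim i)
    have le: "e\<^sup>2 * (cmod (fourier (\<mu>\<^sub>f (m i)) (\<xi> + l)))\<^sup>2 \<le> (cmod (fourier \<mu> (\<xi> + l)))\<^sup>2" if "l \<in> \<Lambda> i" for l
    proof -
      have "e \<le> cmod (fourier (\<tau> (m i)) ((\<xi> + l) v* Q (m i)))"
        using nv[of i] that elim(2) unfolding nonvanishing_at_def vector_matrix_left_distrib
        by (metis add.commute)
      then have "e\<^sup>2 \<le> (cmod (fourier (\<tau> (m i)) ((\<xi> + l) v* Q (m i))))\<^sup>2"
        using e by (intro power_mono) auto
      then show ?thesis
        unfolding split[of _ i] norm_mult power_mult_distrib
        by (subst mult.commute) (rule mult_left_mono, auto)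
    qed
    \<comment> \<open>\<open>T i\<close> is the share of \<open>F\<close> in a total of 1, so
      \<open>1 - T i\<close> is exactly the mass off \<open>F\<close>.\<close>
    have "e\<^sup>2 * (1 - T i) = e\<^sup>2 * (\<Sum>l\<in>\<Lambda> i - F. (cmod (fourier (\<mu>\<^sub>f (m i)) (\<xi> + l)))\<^sup>2)"
      using tight[of i] by (simp add: tight_frame_def T_def sum_diff[OF fin elim(1)])
    also have "\<dots> \<le> (\<Sum>l\<in>\<Lambda> i - F. (cmod (fourier \<mu> (\<xi> + l)))\<^sup>2)"
      unfolding sum_distrib_left by (rule sum_mono) (use le in auto)
    also have "\<dots> = S (\<Lambda> i) - S F"
      unfolding S_def by (rule sum_diff[OF fin elim(1)])
    also have "\<dots> \<le> e\<^sup>2 * \<delta>"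
      using F_max[OF fin, of i] by (simp add: UN_upper mult.commute)
    finally show ?case using e by (simp add: mult_le_cancel_left_pos)
  qed
  \<comment> \<open>With \<open>F\<close> fixed and finite, the limit can be taken term by
    term.\<close>
  have "T \<longlonglongrightarrow> S F"
    unfolding T_def S_def
    by (intro tendsto_sum tendsto_power tendsto_norm
        filterlim_compose[OF weak_conv_to_fourier[OF borel_prob_conv_seq \<mu>] mlim])
  then have "1 - \<delta> \<le> S F"
    by (rule tendsto_lowerbound[OF _ ev]) simp
  then show "\<exists>F. finite F \<and> F \<subseteq> (\<Union>i. \<Lambda> i) \<and> 1 - \<delta> \<le> (\<Sum>l\<in>F. (cmod (fourier \<mu> (\<xi> + l)))\<^sup>2)"
    using F(1,2) unfolding S_def by blast
qed

end

theorem theorem1p2: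
  fixes R :: "nat \<Rightarrow> real ^ 'n ^ 'n"
    and B :: "nat \<Rightarrow> (real ^ 'n) set"
    and \<mu> \<nu> :: "(real ^ 'n) measure"
    and \<nu>tail :: "nat \<Rightarrow> (real ^ 'n) measure"
    and nj :: "nat \<Rightarrow> nat"
  assumes adm: "\<And>n. n \<ge> 1 \<Longrightarrow> admissible_pair (R n) (B n)"
    and mu: "borel_prob \<mu>" "weak_conv_to (\<lambda>n. conv_seq (factor R B 0) n) \<mu>"
    and norm0: "(\<lambda>n. norm (invprod R n)) \<longlonglongrightarrow> 0"
    and tails: "\<And>n. n \<ge> 1 \<Longrightarrow>
                  borel_prob (\<nu>tail n) \<and> weak_conv_to (\<lambda>k. conv_seq (factor R B n) k) (\<nu>tail n)"
    and sub: "strict_mono nj" "\<And>j. nj j \<ge> 1"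
    and nu: "borel_prob \<nu>" "weak_conv_to (\<lambda>j. \<nu>tail (nj j)) \<nu>"
    and Z: "periodic_zero_set \<nu> = {}"
  shows "spectral_measure \<mu> \<and> (\<exists>\<Lambda>. spectrum_of \<mu> \<Lambda> \<and> \<Lambda> \<subseteq> int_lattice)"
proof -
  interpret admissible_sequence R B by unfold_locales (rule adm)
  have "borel_prob (\<nu>tail (nj j))" for j using tails[OF sub(2)] by blast
  then obtain e where e: "e > 0" and nv: "\<forall>\<^sub>F j in sequentially.
      (\<forall>x. \<exists>k\<in>int_lattice. \<forall>y. norm y < e \<longrightarrow> e \<le> cmod (fourier (\<nu>tail (nj j)) (x + k + y))) \<and>
      (\<forall>y. norm y < e \<longrightarrow> e \<le> cmod (fourier (\<nu>tail (nj j)) y))"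
    using fourier_uniformly_nonvanishing[OF _ nu Z] by blast
  obtain m \<Lambda> where m: "strict_mono m" "\<And>i. m i \<ge> 1" and \<Lambda>: "incseq \<Lambda>"
    and tight: "\<And>i. tight_frame (\<mu>\<^sub>f (m i)) (\<Lambda> i)"
    and nva: "\<And>i. nonvanishing_at \<nu>tail (e / 2) (m i) (\<Lambda> i)"
    using frame_sequence[OF norm0 e sub(1) nv] by blast
  have "spectrum_of \<mu> (\<Union>i. \<Lambda> i)"
    using frame_sequence_complete[OF mu norm0 _ tails m \<Lambda> tight nva] e by simp
  moreover have "(\<Union>i. \<Lambda> i) \<subseteq> int_lattice"
    using tight by (auto simp: tight_frame_def)
  ultimately show ?thesis unfolding spectral_measure_def by blast
qed

end
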